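(* An expanding Thurston map $f\colon S^2\to S^2$ with at least one periodic critical point cannot be (topologically) conjugate to a $C^\infty$-map on the Euclidean $2$-sphere.
   Context: Conventions: $\mathbb{N}=\{1,2,3,\dots\}$, $\mathbb{N}_0=\mathbb{N}\cup\{0\}$; $S^2$ is an oriented topological $2$-sphere. Expanding Thurston maps: A continuous map $f\colon S^2\to S^2$ is a branched covering map if for each $x\in S^2$ there exist $d\in\mathbb{N}$ (the local degree of $f$ at $x$, denoted $\deg_f(x)$), open neighborhoods $U$ of $x$ and $V$ of $y=f(x)$, open neighborhoods $U',V'$ of $0$ in $\widehat{\mathbb{C}}$, and orientation-preserving homeomorphisms $\varphi\colon U\to U'$, $\eta\colon V\to V'$ with $\varphi(x)=0$, $\eta(y)=0$ and $(\eta\circ f\circ\varphi^{-1})(z)=z^d$ for all $z\in U'$. The degree is $\deg f=\sum_{x\in f^{-1}(y)}\deg_f(x)$ (independent of $y$). A point $x$ is a critical point if $\deg_f(x)\ge 2$; $\operatorname{crit} f$ is the set of critical points, and $\operatorname{post} f=\{f^n(x) : x\in\operatorname{crit} f,\ n\in\mathbb{N}\}$. A Thurston map is a branched covering map with $\deg f\ge2$ and $\operatorname{post} f$ finite. For a Jordan curve $\mathcal{C}\subseteq S^2$ with $\operatorname{post} f\subseteq\mathcal{C}$, the $n$-tiles ($n\in\mathbb{N}_0$) are the closures of the connected components of $S^2\setminus f^{-n}(\mathcal{C})$. A Thurston map $f$ is expanding if there exist a metric $d$ on $S^2$ inducing the standard topology and a Jordan curve $\mathcal{C}\supseteq\operatorname{post}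 f$ such that the maximal $d$-diameter of $n$-tiles tends to $0$ as $n\to+\infty$. A periodic critical point is a critical point $x$ with $f^n(x)=x$ for some $n\in\mathbb{N}$. *)

theory Defs
  imports "HOL-Analysis.Analysis" "HOL-Homology.Homology"
begin

section \<open>Oriented topological 2-spheres\<close>

abbreviation euclidean_2_sphere :: "(real ^ 3) set" where
  "euclidean_2_sphere \<equiv> sphere 0 1"

text \<open>An orientation of a topological 2-sphere is a choice of a generator of its second singular
  homology group with integer coefficients.\<close>

definition oriented_2_sphere :: "'a topology \<Rightarrow> 'a chain set \<Rightarrow> bool" where
  "oriented_2_sphere X \<omega> \<longleftrightarrow>
     X homeomorphic_space top_of_set euclidean_2_sphere \<and>
     \<omega> \<in> carrier (homology_group 2 X) \<and>
     generate (homology_group 2 X) {\<omega>} = carrier (homology_group 2 X)"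

definition local_orientation :: "'a topology \<Rightarrow> 'a chain set \<Rightarrow> 'a \<Rightarrow> 'a chain set" where
  "local_orientation X \<omega> x = hom_induced 2 X {} X (topspace X - {x}) id \<omega>"

text \<open>For an open set \<open>U\<close>, inclusion induces an isomorphism (excision) from
  \<open>H\<^sub>2(U, U - {x})\<close> to \<open>H\<^sub>2(X, X - {x})\<close>, so exactly one class \<open>c\<close> below corresponds to the local
  orientation of \<open>X\<close> at \<open>x\<close>.\<close>

definition orientation_preserving_on ::
    "'a topology \<Rightarrow> 'a chain set \<Rightarrow> 'b topology \<Rightarrow> 'b chain set \<Rightarrow> 'a set \<Rightarrow> ('a \<Rightarrow> 'b) \<Rightarrow> bool" where
  "orientation_preserving_on X \<omega> Y \<eta> U \<phi> \<longleftrightarrow>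
     (\<forall>x\<in>U. \<forall>c \<in> carrier (relative_homology_group 2 (subtopology X U) (U - {x})).
        hom_induced 2 (subtopology X U) (U - {x}) X (topspace X - {x}) id c
          = local_orientation X \<omega> x \<longrightarrow>
        hom_induced 2 (subtopology X U) (U - {x}) Y (topspace Y - {\<phi> x}) \<phi> c
          = local_orientation Y \<eta> (\<phi> x))"

text \<open>The Riemann sphere; \<open>None\<close> is the point at infinity.\<close>

abbreviation riemann_sphere :: "complex option topology" where
  "riemann_sphere \<equiv> Alexandroff_compactification euclidean"

text \<open>The standard orientation is the one whose localisation at \<open>0\<close> is represented by the affine
  triangle with vertices the cube roots of unity, taken counterclockwise.\<close>

definition unit_triangle :: "(nat \<Rightarrow> real) \<Rightarrow> complex option" where
  "unit_triangle =
     restrict (\<lambda>t. Some (\<Sum>i\<le>2. complex_of_real (t i) * cis (2 * pi * real i / 3)))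
       (standard_simplex 2)"

definition riemann_sphere_orientation :: "complex option chain set" where
  "riemann_sphere_orientation =
     (THE \<omega>. oriented_2_sphere riemann_sphere \<omega> \<and>
        local_orientation riemann_sphere \<omega> (Some 0) =
          homologous_rel_set 2 riemann_sphere (topspace riemann_sphere - {Some 0})
            (frag_of unit_triangle))"


section \<open>Thurston maps\<close>

text \<open>In the following definitions \<open>\<omega>\<close> is the orientation of the topological 2-sphere \<open>X\<close>.
  Only the values of \<open>f\<close> on \<open>topspace X\<close> matter.\<close>

definition chart_at_zero ::
    "'a topology \<Rightarrow> 'a chain set \<Rightarrow> 'a \<Rightarrow> 'a set \<Rightarrow> complex option set \<Rightarrow> ('a \<Rightarrow> complex option) \<Rightarrow> bool"
  where
  "chart_at_zero X \<omega> x U U' \<phi> \<longleftrightarrow>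
     openin X U \<and> x \<in> U \<and> openin riemann_sphere U' \<and> Some 0 \<in> U' \<and>
     homeomorphic_map (subtopology X U) (subtopology riemann_sphere U') \<phi> \<and>
     orientation_preserving_on X \<omega> riemann_sphere riemann_sphere_orientation U \<phi> \<and>
     \<phi> x = Some 0"

definition has_local_degree ::
    "'a topology \<Rightarrow> 'a chain set \<Rightarrow> ('a \<Rightarrow> 'a) \<Rightarrow> 'a \<Rightarrow> nat \<Rightarrow> bool" where
  "has_local_degree X \<omega> f x d \<longleftrightarrow> d \<ge> 1 \<and>
     (\<exists>U V U' V' \<phi> \<eta>.
        chart_at_zero X \<omega> x U U' \<phi> \<and> chart_at_zero X \<omega> (f x) V V' \<eta> \<and>
        f ` U \<subseteq> V \<and>
        (\<forall>z\<in>U'. \<eta> (f (inv_into U \<phi> z)) = map_option (\<lambda>w. w ^ d) z))"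

definition branched_covering_map :: "'a topology \<Rightarrow> 'a chain set \<Rightarrow> ('a \<Rightarrow> 'a) \<Rightarrow> bool" where
  "branched_covering_map X \<omega> f \<longleftrightarrow>
     continuous_map X X f \<and> (\<forall>x \<in> topspace X. \<exists>d. has_local_degree X \<omega> f x d)"

definition local_degree :: "'a topology \<Rightarrow> 'a chain set \<Rightarrow> ('a \<Rightarrow> 'a) \<Rightarrow> 'a \<Rightarrow> nat" where
  "local_degree X \<omega> f x = (THE d. has_local_degree X \<omega> f x d)"

definition map_degree :: "'a topology \<Rightarrow> 'a chain set \<Rightarrow> ('a \<Rightarrow> 'a) \<Rightarrow> nat" where
  "map_degree X \<omega> f =
     (THE n. \<forall>y \<in> topspace X. (\<Sum>x | x \<in> topspace X \<and> f x = y. local_degree X \<omega> f x) = n)"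

definition crit :: "'a topology \<Rightarrow> 'a chain set \<Rightarrow> ('a \<Rightarrow> 'a) \<Rightarrow> 'a set" where
  "crit X \<omega> f = {x \<in> topspace X. local_degree X \<omega> f x \<ge> 2}"

definition post :: "'a topology \<Rightarrow> 'a chain set \<Rightarrow> ('a \<Rightarrow> 'a) \<Rightarrow> 'a set" where
  "post X \<omega> f = {(f ^^ n) x |x n. x \<in> crit X \<omega> f \<and> n \<ge> 1}"

definition Thurston_map :: "'a topology \<Rightarrow> 'a chain set \<Rightarrow> ('a \<Rightarrow> 'a) \<Rightarrow> bool" where
  "Thurston_map X \<omega> f \<longleftrightarrow>
     branched_covering_map X \<omega> f \<and> map_degree X \<omega> f \<ge> 2 \<and> finite (post X \<omega> f)"

definition Jordan_curve :: "'a topology \<Rightarrow> 'a set \<Rightarrow> bool" where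
  "Jordan_curve X C \<longleftrightarrow>
     C \<subseteq> topspace X \<and> subtopology X C homeomorphic_space top_of_set (sphere (0::complex) 1)"

definition tiles :: "'a topology \<Rightarrow> ('a \<Rightarrow> 'a) \<Rightarrow> 'a set \<Rightarrow> nat \<Rightarrow> 'a set set" where
  "tiles X f C n =
     (\<lambda>K. X closure_of K) `
       connected_components_of (subtopology X (topspace X - {x \<in> topspace X. (f ^^ n) x \<in> C}))"

definition metric_diameter :: "('a \<Rightarrow> 'a \<Rightarrow> real) \<Rightarrow> 'a set \<Rightarrow> real" where
  "metric_diameter d T = (SUP (x, y) \<in> T \<times> T. d x y)"

text \<open>There are only finitely many \<open>n\<close>-tiles, so the supremum over the tiles is a maximum.\<close>

definition expanding_Thurston_map :: "'a topology \<Rightarrow> 'a chain set \<Rightarrow> ('a \<Rightarrow> 'a) \<Rightarrow> bool" where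
  "expanding_Thurston_map X \<omega> f \<longleftrightarrow> Thurston_map X \<omega> f \<and>
     (\<exists>d C. Metric_space (topspace X) d \<and> Metric_space.mtopology (topspace X) d = X \<and>
        Jordan_curve X C \<and> post X \<omega> f \<subseteq> C \<and>
        (\<lambda>n. SUP T \<in> tiles X f C n. metric_diameter d T) \<longlonglongrightarrow> 0)"

definition periodic_critical_point :: "'a topology \<Rightarrow> 'a chain set \<Rightarrow> ('a \<Rightarrow> 'a) \<Rightarrow> 'a \<Rightarrow> bool" where
  "periodic_critical_point X \<omega> f x \<longleftrightarrow> x \<in> crit X \<omega> f \<and> (\<exists>n\<ge>1. (f ^^ n) x = x)"


section \<open>Smooth maps on the Euclidean sphere and conjugacy\<close>

text \<open>\<open>C_on k F U\<close> is meant for open \<open>U\<close>: all iterated directional derivatives of \<open>F\<close> of order less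
  than \<open>k\<close> are differentiable on \<open>U\<close>, and those of order \<open>k\<close> are continuous.\<close>

primrec C_on :: "nat \<Rightarrow> ('a::euclidean_space \<Rightarrow> 'b::euclidean_space) \<Rightarrow> 'a set \<Rightarrow> bool" where
  "C_on 0 F U \<longleftrightarrow> continuous_on U F"
| "C_on (Suc k) F U \<longleftrightarrow>
     (\<forall>x\<in>U. F differentiable (at x)) \<and> (\<forall>v. C_on k (\<lambda>x. frechet_derivative F (at x) v) U)"

text \<open>Smoothness on the submanifold \<open>euclidean_2_sphere\<close>: near each point the map is the restriction
  of a smooth map on an open subset of the ambient space.\<close>

definition smooth_sphere_map :: "(real ^ 3 \<Rightarrow> real ^ 3) \<Rightarrow> bool" where
  "smooth_sphere_map g \<longleftrightarrow>
     g ` euclidean_2_sphere \<subseteq> euclidean_2_sphere \<and>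
     (\<forall>p \<in> euclidean_2_sphere. \<exists>U F. open U \<and> p \<in> U \<and> (\<forall>k. C_on k F U) \<and>
        (\<forall>x \<in> U \<inter> euclidean_2_sphere. F x = g x))"

definition topologically_conjugate ::
    "'a topology \<Rightarrow> ('a \<Rightarrow> 'a) \<Rightarrow> 'b topology \<Rightarrow> ('b \<Rightarrow> 'b) \<Rightarrow> bool" where
  "topologically_conjugate X f Y g \<longleftrightarrow>
     (\<exists>h. homeomorphic_map X Y h \<and> (\<forall>x \<in> topspace X. h (f x) = g (h x)))"

end

theory Submission
  imports Defs
begin

text \<open>
  The obstruction is local and sits at a periodic critical point \<open>x\<close>, say with \<open>(f ^^ N) x = x\<close>. Let \<open>g\<close>
  be a smooth map conjugate to \<open>f\<close>, let \<open>p\<close> be the point corresponding to \<open>x\<close>, and let \<open>G = g ^^ N\<close>.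
  Two facts about the dynamics near these points contradict each other.

  On the one hand, expansion makes \<open>x\<close> repelling: it has a neighbourhood in which no orbit of \<open>f ^^ N\<close>
  stays forever, except that of \<open>x\<close> (\<open>expanding_Thurston_map_isolating_neighbourhood\<close>). The reason is that
  a branched covering map sends components of the complement of one preimage of the Jordan curve \<open>C\<close>
  onto components of the next (\<open>open_map_image_component\<close>). If the first \<open>n\<close> points of an orbit are near
  \<open>x\<close>, then pulling back along the orbit a tile of a fixed level that contains \<open>x\<close> produces a tile
  whose level grows linearly in \<open>n\<close> and that joins the initial point to \<open>x\<close>; such tiles shrink to points
  (\<open>fixed_point_isolating_neighbourhood\<close>). The Jordan curve theorem enters because it bounds the number
  of tiles of a given level and shows that preimages of \<open>C\<close> are nowhere dense.

  On the other hand, \<open>f\<close> is a power map of degree at least \<open>2\<close> near \<open>x\<close>, so \<open>g\<close> is not injective near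
  \<open>p\<close>, and by the inverse function theorem the derivative of \<open>g\<close> at \<open>p\<close>, hence also that of \<open>G\<close>, kills
  some tangent vector. A fixed point with such a degenerate derivative cannot repel all points
  (\<open>degenerate_fixed_point_traps_nearby_point\<close>). If the other eigenvalue is \<open>0\<close> too, the map does not
  expand a suitable gauge near \<open>p\<close>. Otherwise consider a thin cone around the kernel direction. Inside it
  \<open>G\<close> moves points no farther from \<open>p\<close>, while the two sides of the cone are mapped to sides of the
  cone. An arc that crosses the cone is mapped to an arc that crosses it again, and nested intervals
  yield a point of the arc whose orbit never leaves the cone
  (\<open>arc_across_cone_contains_trapped_point\<close>).
\<close>

section \<open>Local behaviour of branched covering maps\<close>

lemma openin_riemann_sphere_ball:
  assumes "openin riemann_sphere W" "Some 0 \<in> W"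
  obtains e where "e > 0" "Some ` ball 0 e \<subseteq> W"
proof -
  have "open (Some -` W)"
    using openin_continuous_map_preimage [OF continuous_map_Some assms(1)]
    by (simp add: vimage_def)
  then obtain e where "e > 0" "ball 0 e \<subseteq> Some -` W"
    using assms(2) by (meson openE vimageI)
  then show thesis
    using that by auto
qed

lemma chart_at_zero_bij:
  assumes "chart_at_zero X \<omega> x U U' \<phi>"
  shows "inj_on \<phi> U" "\<phi> ` U = U'"
proof -
  have "openin X U" "openin riemann_sphere U'"
    and hU: "homeomorphic_map (subtopology X U) (subtopology riemann_sphere U') \<phi>"
    using assms unfolding chart_at_zero_def by auto
  then have "topspace (subtopology X U) = U" "topspace (subtopology riemann_sphere U') = U'"
    by (meson openin_subset topspace_subtopology_subset)+
  then show "inj_on \<phi> U" "\<phi> ` U = U'"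
    using hU by (auto simp: homeomorphic_eq_everything_map)
qed

text \<open>Charts may be shrunk: inside any neighbourhood \<open>W\<close> of \<open>x\<close> there is still a full parametrised disc
  on which \<open>f\<close> is a power map. The set of points that \<open>\<eta>\<close> sends into the disc of radius
  \<open>e ^ d\<close> is exactly what the power map covers, and this is why the image of \<open>W\<close> is a
  neighbourhood of \<open>f x\<close>.\<close>

lemma local_power_form:
  fixes X :: "'a topology"
  assumes "has_local_degree X \<omega> f x d" "openin X W" "x \<in> W"
  obtains e and V :: "'a set" and \<eta> :: "'a \<Rightarrow> complex option" and \<psi> :: "complex \<Rightarrow> 'a"
    where "e > 0" "f x \<in> V" "inj_on \<eta> V"
    "openin X {v \<in> V. \<eta> v \<in> Some ` ball 0 (e ^ d)}" "\<eta> (f x) = Some 0"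
    "inj_on \<psi> (ball 0 e)" "\<psi> ` ball 0 e \<subseteq> W"
    "\<forall>w \<in> ball 0 e. f (\<psi> w) \<in> V \<and> \<eta> (f (\<psi> w)) = Some (w ^ d)"
proof -
  obtain U V U' V' \<phi> \<eta> where
    \<phi>: "chart_at_zero X \<omega> x U U' \<phi>" and \<eta>: "chart_at_zero X \<omega> (f x) V V' \<eta>"
    and fU: "f ` U \<subseteq> V"
    and pow: "\<forall>z \<in> U'. \<eta> (f (inv_into U \<phi> z)) = map_option (\<lambda>w. w ^ d) z"
    using assms(1) unfolding has_local_degree_def by (elim conjE exE) (rule that)
  have U: "openin X U" "x \<in> U" "openin riemann_sphere U'" "\<phi> x = Some 0"
    and hU: "homeomorphic_map (subtopology X U) (subtopology riemann_sphere U') \<phi>"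
    using \<phi> unfolding chart_at_zero_def by auto
  have V: "openin X V" "f x \<in> V" "openin riemann_sphere V'" "\<eta> (f x) = Some 0"
    and hV: "homeomorphic_map (subtopology X V) (subtopology riemann_sphere V') \<eta>"
    using \<eta> unfolding chart_at_zero_def by auto
  have tV: "topspace (subtopology X V) = V"
    using V by (meson openin_subset topspace_subtopology_subset)
  note bU = chart_at_zero_bij [OF \<phi>]
  note bV = chart_at_zero_bij [OF \<eta>]
  have "openin (subtopology X U) (U \<inter> W)"
    using assms(2) by (metis inf_commute openin_subtopology_Int)
  then have "openin (subtopology riemann_sphere U') (\<phi> ` (U \<inter> W))"
    using hU by (meson homeomorphic_imp_open_map open_map_def)
  then have "openin riemann_sphere (\<phi> ` (U \<inter> W))"
    using U(3) openin_trans_full by blast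
  moreover have "Some 0 \<in> \<phi> ` (U \<inter> W)"
    using U assms by force
  ultimately obtain e where e: "e > 0" "Some ` ball 0 e \<subseteq> \<phi> ` (U \<inter> W)"
    by (rule openin_riemann_sphere_ball)
  have inv: "inv_into U \<phi> (Some w) \<in> U \<inter> W" if "w \<in> ball 0 e" for w
  proof -
    have "Some w \<in> \<phi> ` (U \<inter> W)" using e that by blast
    then obtain y where "y \<in> U \<inter> W" "\<phi> y = Some w" by auto
    then show ?thesis
      by (metis Int_iff bU(1) inv_into_f_f)
  qed
  have inU': "Some w \<in> U'" if "w \<in> ball 0 e" for w
    using e(2) bU(2) that by blast
  show thesis
  proof (rule that [of e V \<eta> "\<lambda>w. inv_into U \<phi> (Some w)"])
    show "openin X {v \<in> V. \<eta> v \<in> Some ` ball 0 (e ^ d)}"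
    proof -
      have "continuous_map (subtopology X V) riemann_sphere \<eta>"
        using hV homeomorphic_imp_continuous_map continuous_map_in_subtopology by blast
      moreover have "openin riemann_sphere (Some ` ball (0::complex) (e ^ d))"
        by simp
      ultimately have "openin (subtopology X V) {v \<in> topspace (subtopology X V). \<eta> v \<in> Some ` ball 0 (e ^ d)}"
        by (rule openin_continuous_map_preimage)
      then show ?thesis
        using V(1) tV openin_trans_full by metis
    qed
    show "inj_on (\<lambda>w. inv_into U \<phi> (Some w)) (ball 0 e)"
      by (rule inj_onI) (metis bU(2) inU' inv_into_injective option.inject)
    show "\<forall>w \<in> ball 0 e. f (inv_into U \<phi> (Some w)) \<in> V \<and> \<eta> (f (inv_into U \<phi> (Some w))) = Some (w ^ d)"
    proof
      fix w assume w: "w \<in> ball (0::complex) e"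
      show "f (inv_into U \<phi> (Some w)) \<in> V \<and> \<eta> (f (inv_into U \<phi> (Some w))) = Some (w ^ d)"
        using inv [OF w] bspec [OF pow inU' [OF w]] fU by auto
    qed
  qed (use e V bV inv in auto)
qed

text \<open>Openness is a local matter, and a power map of positive degree covers a disc because complex
  numbers have \<open>d\<close>-th roots.\<close>

lemma branched_covering_map_open:
  fixes X :: "'a topology"
  assumes "branched_covering_map X \<omega> f"
  shows "open_map X X f"
  unfolding open_map_def
proof (intro strip)
  fix W assume W: "openin X W"
  show "openin X (f ` W)"
  proof (subst openin_subopen, clarify)
    fix x assume x: "x \<in> W"
    then have "x \<in> topspace X" using W openin_subset by blast
    then obtain d where d: "has_local_degree X \<omega> f x d"
      using assms unfolding branched_covering_map_def by blast
    then have "d \<ge> 1" unfolding has_local_degree_def by blast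
    obtain e and V :: "'a set" and \<eta> :: "'a \<Rightarrow> complex option" and \<psi> :: "complex \<Rightarrow> 'a"
      where e: "e > 0" and V: "f x \<in> V" and \<eta>: "inj_on \<eta> V"
      "openin X {v \<in> V. \<eta> v \<in> Some ` ball 0 (e ^ d)}" "\<eta> (f x) = Some 0"
      and \<psi>: "inj_on \<psi> (ball 0 e)" "\<psi> ` ball 0 e \<subseteq> W"
      and pow: "\<forall>w \<in> ball 0 e. f (\<psi> w) \<in> V \<and> \<eta> (f (\<psi> w)) = Some (w ^ d)"
      by (rule local_power_form [OF d W x]) (rule that)
    let ?T = "{v \<in> V. \<eta> v \<in> Some ` ball 0 (e ^ d)}"
    have "v \<in> f ` W" if v: "v \<in> V" "\<eta> v = Some u" "u \<in> ball 0 (e ^ d)" for u v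
    proof -
      have u: "norm u < e ^ d" using v by simp
      obtain w where w: "w ^ d = u"
        using exists_complex_root[of d u] \<open>d \<ge> 1\<close> by (metis not_one_le_zero)
      then have "norm w ^ d < e ^ d"
        using u by (simp add: norm_power flip: w)
      then have "w \<in> ball 0 e"
        using e by (simp add: power_less_imp_less_base)
      then have "f (\<psi> w) \<in> V" "\<eta> (f (\<psi> w)) = \<eta> v" "\<psi> w \<in> W"
        using pow v(2) w \<psi>(2) by auto
      then have "f (\<psi> w) = v" using \<eta>(1) v(1) by (meson inj_onD)
      with \<open>\<psi> w \<in> W\<close> show ?thesis by blast
    qed
    then have "?T \<subseteq> f ` W" by auto
    moreover have "f x \<in> ?T" using V \<eta> e by auto
    ultimately show "\<exists>T. openin X T \<and> f x \<in> T \<and> T \<subseteq> f ` W"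
      using \<eta>(2) by blast
  qed
qed

text \<open>The only zero of a power map is \<open>0\<close>. The point at infinity may belong to the range of the
  chart, but it is fixed by the power map.\<close>

lemma has_local_degree_isolated:
  assumes "has_local_degree X \<omega> f x d"
  obtains U where "openin X U" "x \<in> U" "\<And>y. \<lbrakk>y \<in> U; f y = f x\<rbrakk> \<Longrightarrow> y = x"
proof -
  obtain U V U' V' \<phi> \<eta> where
    \<phi>: "chart_at_zero X \<omega> x U U' \<phi>" and \<eta>: "chart_at_zero X \<omega> (f x) V V' \<eta>"
    and fU: "f ` U \<subseteq> V"
    and pow: "\<forall>z \<in> U'. \<eta> (f (inv_into U \<phi> z)) = map_option (\<lambda>w. w ^ d) z"
    using assms(1) unfolding has_local_degree_def by (elim conjE exE) (rule that)
  have U: "openin X U" "x \<in> U" "\<phi> x = Some 0"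
    using \<phi> unfolding chart_at_zero_def by auto
  note bU = chart_at_zero_bij [OF \<phi>]
  have d: "d \<ge> 1" using assms unfolding has_local_degree_def by blast
  show thesis
  proof (rule that [OF U(1,2)])
    fix y assume y: "y \<in> U" "f y = f x"
    have "inv_into U \<phi> (\<phi> y) = y" using bU y by simp
    moreover have "\<phi> y \<in> U'" using bU y by blast
    ultimately have "map_option (\<lambda>w. w ^ d) (\<phi> y) = \<eta> (f y)"
      using pow by auto
    also have "\<dots> = Some 0" using y \<eta> unfolding chart_at_zero_def by simp
    finally have "\<phi> y = Some 0" using d by auto
    then show "y = x" using bU(1) U y by (metis inj_onD)
  qed
qed

text \<open>The local degree is a definite description, so it carries information only once the admissible
  exponents are pinned down. If \<open>f\<close> were injective near \<open>x\<close>, no exponent \<open>d \<ge> 2\<close> would be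
  admissible, because the power map identifies a small number with its product by a \<open>d\<close>-th root
  of unity; the description would then denote \<open>1\<close>.\<close>

lemma critical_point_not_locally_injective:
  fixes X :: "'a topology"
  assumes "branched_covering_map X \<omega> f" "x \<in> crit X \<omega> f" "openin X W" "x \<in> W"
  shows "\<not> inj_on f W"
proof
  assume inj: "inj_on f W"
  have x: "x \<in> topspace X" "local_degree X \<omega> f x \<ge> 2"
    using assms(2) unfolding crit_def by auto
  have one: "d = 1" if d: "has_local_degree X \<omega> f x d" for d
  proof (rule ccontr)
    assume "d \<noteq> 1"
    then have d2: "d \<ge> 2" using d unfolding has_local_degree_def by linarith
    obtain e and V :: "'a set" and \<eta> :: "'a \<Rightarrow> complex option" and \<psi> :: "complex \<Rightarrow> 'a"
      where e: "e > 0" and V: "f x \<in> V" and \<eta>: "inj_on \<eta> V"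
      "openin X {v \<in> V. \<eta> v \<in> Some ` ball 0 (e ^ d)}" "\<eta> (f x) = Some 0"
      and \<psi>: "inj_on \<psi> (ball 0 e)" "\<psi> ` ball 0 e \<subseteq> W"
      and pow: "\<forall>w \<in> ball 0 e. f (\<psi> w) \<in> V \<and> \<eta> (f (\<psi> w)) = Some (w ^ d)"
      by (rule local_power_form [OF d assms(3,4)]) (rule that)
    define c where "c = complex_of_real (e/2)"
    define \<zeta> where "\<zeta> = cis (2 * pi / real d)"
    have "\<zeta> ^ d = 1"
      unfolding \<zeta>_def using d2 by (simp add: Complex.DeMoivre)
    have "\<zeta> \<noteq> 1"
    proof
      assume "\<zeta> = 1"
      then have "cos (2 * pi / real d) = 1" unfolding \<zeta>_def by (simp add: complex_eq_iff)
      moreover have "cos (2 * pi / real d) < 1"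
      proof -
        have "0 < 2 * pi / real d" "2 * pi / real d \<le> pi"
          using d2 by (auto simp: field_simps)
        then show ?thesis
          using cos_monotone_0_pi[of 0 "2 * pi / real d"] by auto
      qed
      ultimately show False by simp
    qed
    have B: "c \<in> ball 0 e" "c * \<zeta> \<in> ball 0 e"
      using e unfolding c_def \<zeta>_def by (simp_all add: norm_mult)
    have "\<eta> (f (\<psi> c)) = \<eta> (f (\<psi> (c * \<zeta>)))"
      using bspec [OF pow B(1)] bspec [OF pow B(2)] \<open>\<zeta> ^ d = 1\<close>
      by (simp add: power_mult_distrib)
    then have "f (\<psi> c) = f (\<psi> (c * \<zeta>))"
      using inj_onD [OF \<eta>(1)] bspec [OF pow B(1)] bspec [OF pow B(2)] by blast
    then have "\<psi> c = \<psi> (c * \<zeta>)"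
      using inj_onD [OF inj] \<psi>(2) B by blast
    then have "c = c * \<zeta>" using inj_onD [OF \<psi>(1) _ B] by blast
    then show False using \<open>\<zeta> \<noteq> 1\<close> e unfolding c_def by simp
  qed
  obtain d where "has_local_degree X \<omega> f x d"
    using assms(1) x unfolding branched_covering_map_def by blast
  then have "has_local_degree X \<omega> f x 1"
    using one by metis
  then have "local_degree X \<omega> f x = 1"
    unfolding local_degree_def by (rule the_equality) (rule one)
  then show False using x by simp
qed

text \<open>A fibre is compact, and it is discrete because a power map takes the value \<open>0\<close> only at \<open>0\<close>.\<close>

lemma branched_covering_map_finite_fibres:
  assumes f: "branched_covering_map X \<omega> f" and X: "compact_space X" "Hausdorff_space X"
    and y: "y \<in> topspace X"
  shows "finite {x \<in> topspace X. f x = y}"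
proof -
  let ?F = "{x \<in> topspace X. f x = y}"
  have "closedin X ?F"
    using closedin_continuous_map_preimage [of X X f "{y}"] closedin_Hausdorff_singleton [OF X(2) y] f
    unfolding branched_covering_map_def by simp
  then have comp: "compactin X ?F" using X(1) closedin_compact_space by blast
  have "\<exists>U. openin X U \<and> x \<in> U \<and> U \<inter> ?F \<subseteq> {x}" if x: "x \<in> ?F" for x
  proof -
    obtain d where "has_local_degree X \<omega> f x d"
      using f x unfolding branched_covering_map_def by blast
    then obtain U where "openin X U" "x \<in> U" "\<And>z. \<lbrakk>z \<in> U; f z = f x\<rbrakk> \<Longrightarrow> z = x"
      using has_local_degree_isolated by metis
    then show ?thesis using x by blast
  qed
  then obtain U where U: "\<And>x. x \<in> ?F \<Longrightarrow> openin X (U x) \<and> x \<in> U x \<and> U x \<inter> ?F \<subseteq> {x}"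
    by metis
  have "\<And>V. V \<in> U ` ?F \<Longrightarrow> openin X V" "?F \<subseteq> \<Union>(U ` ?F)" using U by blast+
  from compactinD [OF comp this] obtain \<F> where \<F>: "finite \<F>" "\<F> \<subseteq> U ` ?F" "?F \<subseteq> \<Union>\<F>"
    by blast
  from finite_subset_image [OF \<F>(1,2)] obtain T where T: "T \<subseteq> ?F" "finite T" "\<F> = U ` T"
    by blast
  have "?F \<subseteq> T"
  proof
    fix x assume x: "x \<in> ?F"
    then obtain t where t: "t \<in> T" "x \<in> U t" using \<F>(3) T(3) by blast
    then have "x \<in> {t}" using U [of t] T(1) x by blast
    then show "x \<in> T" using t(1) by simp
  qed
  then show ?thesis using T(2) finite_subset by blast
qed

section \<open>Components of preimages under open maps\<close>

text \<open>The image of a component \<open>K\<close> of the preimage of \<open>B\<close> is open since \<open>f\<close> is open, and it is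
  closed relative to \<open>B\<close> since a limit of points of \<open>K\<close> that lands in \<open>B\<close> lies in the preimage of
  \<open>B\<close>, hence in \<open>K\<close>. Being open, closed and connected it is a whole component. For a branched covering
  map this says that tiles are mapped onto tiles.\<close>

lemma open_map_image_component:
  assumes "compact_space X" "locally_connected_space X" "Hausdorff_space Y"
    and f: "continuous_map X Y f" "open_map X Y f" and B: "openin Y B"
    and K: "K \<in> connected_components_of (subtopology X {x \<in> topspace X. f x \<in> B})"
  shows "f ` K \<in> connected_components_of (subtopology Y B)"
proof -
  define A where "A = {x \<in> topspace X. f x \<in> B}"
  have A: "openin X A"
    unfolding A_def using B f(1) openin_continuous_map_preimage by blast
  note K = K [folded A_def]
  have "openin X K"
    using A K assms(2) locally_connected_space_open_connected_components by blast
  have KA: "K \<subseteq> A"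
    using connected_components_of_subset [OF K] by simp
  have conK: "connectedin X K"
    using connectedin_connected_components_of [OF K] connectedin_subtopology by blast
  have clK: "X closure_of K \<inter> A = K"
    using closedin_connected_components_of [OF K] KA
    by (metis closedin_Int_closure_of inf_commute)
  have "connectedin (subtopology Y B) (f ` K)"
    using connectedin_continuous_map_image [OF f(1) conK] KA
    by (auto simp: connectedin_subtopology A_def)
  moreover obtain k where k: "k \<in> K"
    using nonempty_connected_components_of [OF K] by blast
  moreover have fkB: "f k \<in> topspace (subtopology Y B)"
    using k KA B openin_subset unfolding A_def by fastforce
  ultimately obtain T where T: "T \<in> connected_components_of (subtopology Y B)" "f ` K \<subseteq> T"
    by (metis emptyE exists_connected_component_of_superset topspace_discrete_topology)
  have conT: "connectedin Y T" and TB: "T \<subseteq> B"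
    using connectedin_connected_components_of [OF T(1)] connectedin_subtopology by metis+
  have op: "openin Y (f ` K)"
    using \<open>openin X K\<close> f(2) by (simp add: open_map_def)
  have cl: "closedin Y (f ` (X closure_of K))"
    using continuous_imp_closed_map [OF f(1) assms(1,3)] by (simp add: closed_map_def)
  have meet: "f ` (X closure_of K) \<inter> T \<subseteq> f ` K"
  proof clarify
    fix x assume x: "x \<in> X closure_of K" "f x \<in> T"
    then have "x \<in> A"
      unfolding A_def using TB closure_of_subset_topspace by fastforce
    then show "f x \<in> f ` K" using x clK by blast
  qed
  have "T \<subseteq> f ` K"
  proof (rule ccontr)
    assume "\<not> T \<subseteq> f ` K"
    then have "(topspace Y - f ` (X closure_of K)) \<inter> T \<noteq> {}"
      using meet connectedin_subset_topspace [OF conT] by blast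
    moreover have "f ` K \<inter> T \<noteq> {}" using k T(2) by blast
    moreover have "f ` K \<inter> (topspace Y - f ` (X closure_of K)) \<inter> T = {}"
      using closure_of_subset [of K X] connectedin_subset_topspace [OF conK] by blast
    moreover have "T \<subseteq> f ` K \<union> (topspace Y - f ` (X closure_of K))"
      using meet connectedin_subset_topspace [OF conT] by blast
    moreover have "openin Y (topspace Y - f ` (X closure_of K))"
      using cl by (simp add: openin_diff)
    ultimately show False
      using conT op unfolding connectedin by blast
  qed
  then show ?thesis using T by (metis subset_antisym)
qed

text \<open>To bound the number of components it suffices to exhibit a set that meets all of them.\<close>

lemma connected_components_of_subset_image:
  assumes "\<And>K. K \<in> connected_components_of X \<Longrightarrow> \<exists>e\<in>E. e \<in> K"
  shows "connected_components_of X \<subseteq> connected_component_of_set X ` E"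
proof
  fix K assume K: "K \<in> connected_components_of X"
  then obtain e where e: "e \<in> E" "e \<in> K" using assms by blast
  have "K = connected_component_of_set X e"
    using K e connected_components_of_subset connected_component_in_connected_components_of
      connected_components_of_overlap [OF K, of "connected_component_of_set X e"]
      connected_component_of_refl by (metis IntI empty_iff mem_Collect_eq subsetD)
  then show "K \<in> connected_component_of_set X ` E" using e by blast
qed

text \<open>Every component of the preimage is mapped onto a component of \<open>B\<close>, so it meets the fibre over a
  point chosen in that component; there are only finitely many such fibre points.\<close>

lemma finite_connected_components_of_preimage:
  assumes "compact_space X" "locally_connected_space X" "Hausdorff_space Y"
    and "continuous_map X Y f" "open_map X Y f" "openin Y B"
    and fin: "finite (connected_components_of (subtopology Y B))"
    and fib: "\<And>y. y \<in> topspace Y \<Longrightarrow> finite {x \<in> topspace X. f x = y}"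
  shows "finite (connected_components_of (subtopology X {x \<in> topspace X. f x \<in> B}))"
proof -
  let ?c = "\<lambda>T. SOME y. y \<in> T"
  let ?\<T> = "connected_components_of (subtopology Y B)"
  define E where "E = (\<Union>T \<in> ?\<T>. {x \<in> topspace X. f x = ?c T})"
  have c: "?c T \<in> T" if "T \<in> ?\<T>" for T
    using nonempty_connected_components_of [OF that] by (meson all_not_in_conv someI_ex)
  have TY: "T \<subseteq> topspace Y" if "T \<in> ?\<T>" for T
    using connected_components_of_subset [OF that] by auto
  have "finite E"
    unfolding E_def using fin fib c TY by blast
  moreover have "\<exists>e\<in>E. e \<in> K"
    if K: "K \<in> connected_components_of (subtopology X {x \<in> topspace X. f x \<in> B})" for K
  proof -
    have fK: "f ` K \<in> ?\<T>"
      using open_map_image_component assms K by blast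
    then obtain x where "x \<in> K" "f x = ?c (f ` K)"
      using c [OF fK] by (metis (no_types, lifting) imageE)
    moreover have "x \<in> topspace X"
      using connected_components_of_subset [OF K] \<open>x \<in> K\<close> by auto
    ultimately show ?thesis unfolding E_def using fK by blast
  qed
  ultimately show ?thesis
    by (meson connected_components_of_subset_image finite_imageI finite_subset)
qed

lemma finite_connected_components_of_cover:
  assumes "finite \<U>" "\<And>U. U \<in> \<U> \<Longrightarrow> connectedin X U" "topspace X \<subseteq> \<Union>\<U>"
  shows "finite (connected_components_of X)"
proof -
  have "\<exists>e \<in> (\<lambda>U. SOME x. x \<in> U) ` \<U>. e \<in> K" if K: "K \<in> connected_components_of X" for K
  proof -
    obtain x where x: "x \<in> K" using nonempty_connected_components_of [OF K] by blast
    then obtain U where U: "U \<in> \<U>" "x \<in> U"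
      using connected_components_of_subset [OF K] assms(3) by blast
    then have "U \<subseteq> K"
      using connected_components_of_maximal [OF K] assms(2) x by (meson disjnt_iff)
    moreover have "(SOME x. x \<in> U) \<in> U" using U(2) by (rule someI)
    ultimately show ?thesis using U by blast
  qed
  then show ?thesis
    using assms(1) by (meson connected_components_of_subset_image finite_imageI finite_subset)
qed

section \<open>Topology of the sphere and of Jordan curves\<close>

lemma sphere_2_topology:
  assumes "X homeomorphic_space top_of_set euclidean_2_sphere"
  shows "compact_space X" "Hausdorff_space X" "locally_connected_space X"
proof -
  show "compact_space X"
    using homeomorphic_compact_space [OF assms] by (simp add: compact_space_subtopology)
  show "Hausdorff_space X"
    using homeomorphic_Hausdorff_space [OF assms] by (simp add: Hausdorff_space_subtopology)
  have "locally connected euclidean_2_sphere" by (rule locally_connected_sphere)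
  then have "\<exists>U. openin (top_of_set euclidean_2_sphere) U \<and> connectedin (top_of_set euclidean_2_sphere) U \<and> x \<in> U \<and> U \<subseteq> V"
    if "openin (top_of_set euclidean_2_sphere) V" "x \<in> V" for V x
    using that openin_imp_subset unfolding locally_connected connectedin_subtopology connectedin_iff_connected
    by meson
  then have "locally_connected_space (top_of_set euclidean_2_sphere)"
    unfolding locally_connected_space by blast
  then show "locally_connected_space X"
    using homeomorphic_locally_connected_space [OF assms] by blast
qed

lemma homeomorphic_circle_simple_loop:
  fixes S :: "complex set"
  assumes "S homeomorphic sphere (0::complex) 1"
  obtains c where "simple_path c" "pathfinish c = pathstart c" "path_image c = S"
proof -
  obtain g h where gh: "homeomorphism (sphere (0::complex) 1) S g h"
    using assms homeomorphic_sym unfolding homeomorphic_def by blast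
  define p where "p = (\<lambda>t. cis (2 * pi * t))"
  have im: "path_image p = sphere 0 1"
  proof
    show "path_image p \<subseteq> sphere 0 1" by (auto simp: path_image_def p_def)
    show "sphere 0 1 \<subseteq> path_image p"
    proof
      fix z :: complex assume "z \<in> sphere 0 1"
      then have z: "z = cis (Arg2pi z)" using Arg2pi_eq [of z] by (simp add: cis_conv_exp)
      have "Arg2pi z / (2 * pi) \<in> {0..1}"
        using Arg2pi_ge_0[of z] Arg2pi_lt_2pi[of z] by (auto simp: field_simps)
      moreover have "z = p (Arg2pi z / (2 * pi))" using z unfolding p_def by simp
      ultimately show "z \<in> path_image p" unfolding path_image_def by blast
    qed
  qed
  have sp: "simple_path p"
  proof -
    have "path p" unfolding path_def p_def by (intro continuous_intros)
    moreover have "s = t \<or> s = 0 \<and> t = 1 \<or> s = 1 \<and> t = 0"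
      if st: "s \<in> {0..1}" "t \<in> {0..1}" "p s = p t" for s t
    proof -
      have "sin (2 * pi * s) = sin (2 * pi * t) \<and> cos (2 * pi * s) = cos (2 * pi * t)"
        using st(3) by (simp add: p_def complex_eq_iff)
      then obtain n :: int where "2 * pi * s = 2 * pi * t + 2 * pi * n"
        using sin_cos_eq_iff by blast
      then have "2 * pi * s = 2 * pi * (t + real_of_int n)" by (simp add: algebra_simps)
      then have n: "s = t + n" by simp
      then have "real_of_int n \<le> 1" "real_of_int n \<ge> -1" using st by auto
      then have "n = -1 \<or> n = 0 \<or> n = 1" by linarith
      then show ?thesis using n st by auto
    qed
    ultimately show ?thesis unfolding simple_path_def loop_free_def by blast
  qed
  show thesis
  proof (rule that [of "g \<circ> p"])
    show "simple_path (g \<circ> p)"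
    proof (rule simple_path_continuous_image [OF sp])
      show "continuous_on (path_image p) g" using gh im by (simp add: homeomorphism_def)
      show "inj_on g (path_image p)" using gh im unfolding homeomorphism_def by (intro inj_on_inverseI [of _ h]) auto
    qed
    show "path_image (g \<circ> p) = S" using gh im by (simp add: path_image_compose homeomorphism_def)
    have "p 0 = p 1" unfolding p_def by simp
    then show "pathfinish (g \<circ> p) = pathstart (g \<circ> p)" by (simp add: pathfinish_def pathstart_def)
  qed
qed

text \<open>Removing a point from each would give a homeomorphism between a line and a plane.\<close>

lemma circle_not_homeomorphic_2_sphere:
  "\<not> sphere (0::complex) 1 homeomorphic (sphere 0 1 :: (real^3) set)"
proof
  assume "sphere (0::complex) 1 homeomorphic (sphere 0 1 :: (real^3) set)"
  then obtain g h where gh: "homeomorphism (sphere (0::complex) 1) (sphere 0 1 :: (real^3) set) g h"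
    unfolding homeomorphic_def by blast
  have g1: "g 1 \<in> sphere 0 1" using gh by (auto simp: homeomorphism_def)
  have inj: "inj_on g (sphere 0 1)" using gh unfolding homeomorphism_def by (intro inj_on_inverseI [of _ h]) auto
  have "homeomorphism (sphere 0 1 - {1}) (sphere 0 1 - {g 1}) g h"
  proof (rule homeomorphism_of_subsets [OF gh])
    have "g ` (sphere 0 1 - {1}) = g ` sphere 0 1 - g ` {1}"
      by (rule inj_on_image_set_diff [OF inj]) auto
    then show "g ` (sphere 0 1 - {1}) = sphere 0 1 - {g 1}" using gh by (simp add: homeomorphism_def)
  qed auto
  then have 1: "(sphere 0 1 - {1::complex}) homeomorphic (sphere 0 1 - {g 1})"
    unfolding homeomorphic_def by blast
  have 2: "(sphere 0 1 - {1::complex}) homeomorphic {x::complex. 1 \<bullet> x = 0}"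
    by (rule homeomorphic_punctured_sphere_hyperplane) auto
  have 3: "(sphere 0 1 - {g 1}) homeomorphic {x::real^3. g 1 \<bullet> x = 0}"
    using g1 by (intro homeomorphic_punctured_sphere_hyperplane) auto
  have "{x::complex. 1 \<bullet> x = 0} homeomorphic {x::real^3. g 1 \<bullet> x = 0}"
    using homeomorphic_trans [OF homeomorphic_trans [OF 2 [THEN homeomorphic_sym [THEN iffD1]] 1] 3] .
  moreover have "g 1 \<noteq> 0" using g1 by auto
  ultimately have "DIM(complex) = DIM(real^3)"
    by (subst (asm) homeomorphic_hyperplanes_eq) auto
  then show False by simp
qed

text \<open>The Jordan curve theorem in the plane. A Jordan curve has empty interior because it is the
  frontier of its open inside.\<close>

lemma homeomorphic_circle_complement:
  fixes S :: "complex set"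
  assumes "S homeomorphic sphere (0::complex) 1"
  obtains I J where "connected I" "connected J" "I \<union> J = - S" "\<And>U. \<lbrakk>open U; U \<subseteq> S\<rbrakk> \<Longrightarrow> U = {}"
proof -
  obtain c where c: "simple_path c" "pathfinish c = pathstart c" "path_image c = S"
    using homeomorphic_circle_simple_loop [OF assms] .
  note J = Jordan_inside_outside [OF c(1,2), unfolded c(3)]
  show thesis
  proof (rule that [of "inside S" "outside S"])
    fix U assume U: "open U" "U \<subseteq> S"
    have "frontier (inside S) = S" "open (inside S)" using J by blast+
    then have "U \<subseteq> closure (inside S)" "U \<inter> inside S = {}"
      using U(2) by (auto simp: frontier_def interior_open)
    then show "U = {}"
      using open_Int_closure_eq_empty [OF U(1), of "inside S"] by blast
  qed (use J in blast)+
qed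

lemma punctured_2_sphere_homeomorphic_plane:
  assumes X: "X homeomorphic_space top_of_set euclidean_2_sphere" and b: "b \<in> topspace X"
  shows "subtopology X (topspace X - {b}) homeomorphic_space (euclidean :: complex topology)"
proof -
  let ?S = "euclidean_2_sphere"
  obtain h k where hk: "homeomorphic_maps X (top_of_set ?S) h k"
    using X unfolding homeomorphic_space_def by blast
  then have h: "homeomorphic_map X (top_of_set ?S) h"
    using homeomorphic_maps_map by blast
  have "inj_on h (topspace X)" "h ` topspace X = ?S"
    using h by (auto simp: homeomorphic_eq_everything_map)
  then have hb: "h b \<in> ?S" and "h ` (topspace X - {b}) = ?S - {h b}"
    using b by (auto simp: inj_on_image_set_diff [where C = "topspace X"])
  then have "homeomorphic_map (subtopology X (topspace X - {b})) (subtopology (top_of_set ?S) (?S - {h b})) h"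
    by (intro homeomorphic_map_subtopologies [OF h]) (simp add: Int_absorb1)
  then have "subtopology X (topspace X - {b}) homeomorphic_space top_of_set (?S - {h b})"
    using homeomorphic_map_imp_homeomorphic_space
    by (metis Diff_subset inf.absorb_iff2 subtopology_subtopology)
  also have "(?S - {h b}) homeomorphic (UNIV :: complex set)"
    by (rule homeomorphic_punctured_sphere_affine) (use hb in auto)
  then have "top_of_set (?S - {h b}) homeomorphic_space (euclidean :: complex topology)"
    by (metis homeomorphic_space_iff_homeomorphic subtopology_UNIV)
  finally show ?thesis .
qed

text \<open>The plane statement is transferred by removing a point \<open>b\<close> off the curve, which exists because
  the curve is not the whole sphere. The complement is then covered by \<open>b\<close> and the two sides of the
  curve in the punctured sphere.\<close>

lemma Jordan_curve_complement:
  assumes X: "X homeomorphic_space top_of_set euclidean_2_sphere" and C: "Jordan_curve X C"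
  shows "closedin X C"
    and "finite (connected_components_of (subtopology X (topspace X - C)))"
    and "\<And>U. \<lbrakk>openin X U; U \<subseteq> C\<rbrakk> \<Longrightarrow> U = {}"
proof -
  have CX: "C \<subseteq> topspace X" and Cc: "subtopology X C homeomorphic_space top_of_set (sphere (0::complex) 1)"
    using C unfolding Jordan_curve_def by auto
  have "Hausdorff_space X"
    using homeomorphic_Hausdorff_space [OF X] by (simp add: Hausdorff_space_subtopology)
  moreover have "compact_space (subtopology X C)"
    using homeomorphic_compact_space [OF Cc] by (simp add: compact_space_subtopology)
  ultimately show "closedin X C"
    using CX compactin_imp_closedin compactin_subspace by blast
  have "C \<noteq> topspace X"
  proof
    assume "C = topspace X"
    then have "top_of_set (sphere (0::complex) 1) homeomorphic_space top_of_set euclidean_2_sphere"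
      using Cc X homeomorphic_space_sym homeomorphic_space_trans by (metis subtopology_topspace)
    then show False using circle_not_homeomorphic_2_sphere by simp
  qed
  then obtain b where b: "b \<in> topspace X" "b \<notin> C" using CX by blast
  define Y where "Y = subtopology X (topspace X - {b})"
  have tY: "topspace Y = topspace X - {b}" unfolding Y_def by auto
  obtain q r where qr: "homeomorphic_maps Y (euclidean :: complex topology) q r"
    using punctured_2_sphere_homeomorphic_plane [OF X b(1)]
    unfolding homeomorphic_space_def Y_def by blast
  have q: "homeomorphic_map Y euclidean q" and r: "homeomorphic_map euclidean Y r"
    and rq: "\<And>x. x \<in> topspace Y \<Longrightarrow> r (q x) = x" and qr': "\<And>z. q (r z) = z"
    using qr by (auto simp: homeomorphic_maps_map)
  have CY: "C \<subseteq> topspace Y" using CX b tY by blast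
  define D where "D = q ` C"
  have "homeomorphic_map (subtopology Y C) (subtopology euclidean D) q"
    by (rule homeomorphic_map_subtopologies [OF q]) (use CY in \<open>auto simp: D_def Int_absorb1\<close>)
  moreover have "subtopology Y C = subtopology X C"
    unfolding Y_def subtopology_subtopology using CX b(2) by (metis CY Int_absorb1 tY)
  ultimately have "top_of_set D homeomorphic_space top_of_set (sphere (0::complex) 1)"
    using Cc homeomorphic_map_imp_homeomorphic_space homeomorphic_space_sym homeomorphic_space_trans
    by metis
  then have "D homeomorphic sphere (0::complex) 1" by simp
  then obtain I J where IJ: "connected I" "connected J" "I \<union> J = - D"
    and D: "\<And>U. \<lbrakk>open U; U \<subseteq> D\<rbrakk> \<Longrightarrow> U = {}"
    using homeomorphic_circle_complement by metis
  have rD: "r z \<in> topspace X - C" if "z \<notin> D" for z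
  proof -
    have "r z \<in> topspace Y" using r homeomorphic_imp_surjective_map by fastforce
    moreover have "r z \<notin> C" using that qr' unfolding D_def by (metis imageI)
    ultimately show ?thesis using tY by blast
  qed
  have con: "connectedin (subtopology X (topspace X - C)) (r ` I)" if "connected I" "I \<subseteq> - D" for I
  proof -
    have "connectedin Y (r ` I)"
      using that(1) connectedin_continuous_map_image [OF homeomorphic_imp_continuous_map [OF r]] by simp
    then show ?thesis
      using rD that(2) unfolding Y_def connectedin_subtopology by blast
  qed
  show "finite (connected_components_of (subtopology X (topspace X - C)))"
  proof (rule finite_connected_components_of_cover [of "{{b}, r ` I, r ` J}"])
    show "topspace (subtopology X (topspace X - C)) \<subseteq> \<Union> {{b}, r ` I, r ` J}"
    proof
      fix x assume "x \<in> topspace (subtopology X (topspace X - C))"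
      then have x: "x \<in> topspace X" "x \<notin> C" by auto
      show "x \<in> \<Union> {{b}, r ` I, r ` J}"
      proof (cases "x = b")
        case False
        then have "x \<in> topspace Y" using x tY by blast
        moreover have "q x \<notin> D"
          using x rq calculation CY unfolding D_def by (metis (no_types, lifting) imageE subsetD)
        ultimately show ?thesis using rq IJ(3) by (metis (no_types, lifting) Compl_iff UnE UnionI imageI insert_iff)
      qed simp
    qed
    show "connectedin (subtopology X (topspace X - C)) U" if "U \<in> {{b}, r ` I, r ` J}" for U
      using that b con IJ by (auto simp: connectedin_sing)
  qed simp
  show "U = {}" if U: "openin X U" "U \<subseteq> C" for U
  proof -
    have "openin Y U"
      unfolding Y_def using U CY tY by (metis Y_def inf.absorb_iff1 openin_subtopology_Int subset_trans)
    then have "open (q ` U)"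
      using q homeomorphic_imp_open_map open_map_def by (metis open_openin)
    then show "U = {}" using D U(2) unfolding D_def by (metis image_is_empty image_mono)
  qed
qed

section \<open>Expansion at periodic points\<close>

lemma continuous_open_map_funpow:
  assumes "continuous_map X X f" "open_map X X f"
  shows "continuous_map X X (f ^^ n)" "open_map X X (f ^^ n)"
proof (induction n)
  case 0
  show "continuous_map X X (f ^^ 0)" "open_map X X (f ^^ 0)" by (auto simp: open_map_def)
next
  case (Suc n)
  show "continuous_map X X (f ^^ Suc n)" "open_map X X (f ^^ Suc n)"
    using Suc assms by (auto intro: continuous_map_compose open_map_compose simp del: o_apply)
qed

lemma finite_fibres_funpow:
  assumes "\<And>y. y \<in> A \<Longrightarrow> finite {x \<in> A. f x = y}" "f ` A \<subseteq> A" "y \<in> A"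
  shows "finite {x \<in> A. (f ^^ n) x = y}"
proof (induction n)
  case (Suc n)
  have "{x \<in> A. (f ^^ Suc n) x = y} \<subseteq> (\<Union>z \<in> {z \<in> A. (f ^^ n) z = y}. {x \<in> A. f x = z})"
    using assms(2) by (auto simp: funpow_swap1)
  then show ?case
    by (rule finite_subset) (use Suc assms(1) in auto)
qed simp

text \<open>Expansion in a form whose conclusion is purely topological, so that it can be combined with
  arguments about components and open sets.\<close>

lemma small_tiles_near_point:
  assumes d: "Metric_space (topspace X) d" "Metric_space.mtopology (topspace X) d = X"
    and X: "compact_space X"
    and mesh: "(\<lambda>n. SUP T \<in> tiles X f C n. metric_diameter d T) \<longlonglongrightarrow> 0"
    and V: "openin X V" "x \<in> V"
  obtains W m where "openin X W" "x \<in> W"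
    "\<And>n K. \<lbrakk>n \<ge> m; K \<in> connected_components_of
        (subtopology X (topspace X - {x \<in> topspace X. (f ^^ n) x \<in> C})); K \<inter> W \<noteq> {}\<rbrakk>
      \<Longrightarrow> X closure_of K \<subseteq> V"
proof -
  interpret M: Metric_space "topspace X" d by (rule d)
  have "M.mbounded (topspace X)"
    using X M.compactin_imp_mbounded d(2) by (simp add: compact_space_def)
  then obtain B where B: "\<And>y z. \<lbrakk>y \<in> topspace X; z \<in> topspace X\<rbrakk> \<Longrightarrow> d y z \<le> B"
    by (auto simp: M.mbounded_alt)
  obtain e where e: "e > 0" "M.mball x e \<subseteq> V"
    using V d(2) M.openin_mtopology by metis
  have xX: "x \<in> topspace X" using V openin_subset by blast
  obtain m where m: "\<And>n. n \<ge> m \<Longrightarrow> (SUP T \<in> tiles X f C n. metric_diameter d T) < e / 2"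
    using order_tendstoD(2) [OF mesh, of "e / 2"] e by (auto simp: eventually_sequentially)
  show thesis
  proof (rule that [of "M.mball x (e / 2)" m])
    show "openin X (M.mball x (e / 2))" using M.openin_mball d(2) by metis
    show "x \<in> M.mball x (e / 2)" using xX e by simp
    fix n K
    assume n: "n \<ge> m" and meets: "K \<inter> M.mball x (e / 2) \<noteq> {}"
      and K: "K \<in> connected_components_of (subtopology X (topspace X - {x \<in> topspace X. (f ^^ n) x \<in> C}))"
    obtain y where y: "y \<in> K" "d x y < e / 2" using meets by auto
    have tile: "X closure_of K \<in> tiles X f C n" using K unfolding tiles_def by blast
    have diam: "d u v \<le> metric_diameter d T" if "u \<in> T" "v \<in> T" "T \<subseteq> topspace X" for u v T
    proof -
      have "bdd_above ((\<lambda>(x, y). d x y) ` (T \<times> T))"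
        using B that(3) by (intro bdd_aboveI [of _ B]) auto
      then have "(\<lambda>(x, y). d x y) (u, v) \<le> metric_diameter d T"
        unfolding metric_diameter_def using that by (intro cSUP_upper) auto
      then show ?thesis by simp
    qed
    have le: "metric_diameter d T \<le> B" if T: "T \<in> tiles X f C n" for T
    proof -
      obtain L where L: "T = X closure_of L" "L \<in> connected_components_of
          (subtopology X (topspace X - {x \<in> topspace X. (f ^^ n) x \<in> C}))"
        using T unfolding tiles_def by blast
      then have "L \<noteq> {}" "L \<subseteq> topspace X"
        using nonempty_connected_components_of connected_components_of_subset by fastforce+
      then have "T \<noteq> {}" "T \<subseteq> topspace X"
        using L(1) closure_of_subset closure_of_subset_topspace by fastforce+
      then show ?thesis
        unfolding metric_diameter_def using B by (intro cSUP_least) auto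
    qed
    have "metric_diameter d (X closure_of K) \<le> (SUP T \<in> tiles X f C n. metric_diameter d T)"
      by (rule cSUP_upper [OF tile]) (rule bdd_aboveI2 [of _ _ B], rule le)
    then have small: "metric_diameter d (X closure_of K) < e / 2" using m [OF n] by linarith
    show "X closure_of K \<subseteq> V"
    proof
      fix z assume z: "z \<in> X closure_of K"
      have KX: "K \<subseteq> topspace X" using connected_components_of_subset [OF K] by auto
      then have "y \<in> X closure_of K" using y(1) closure_of_subset by blast
      then have "d y z < e / 2"
        using diam [OF _ z closure_of_subset_topspace, of y] small by linarith
      moreover have "y \<in> topspace X" "z \<in> topspace X"
        using KX y(1) z closure_of_subset_topspace by fastforce+
      ultimately have "z \<in> M.mball x e"
        using M.triangle [of x y z] y(2) xX by simp
      then show "z \<in> V" using e by blast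
    qed
  qed
qed

text \<open>An expanding map repels from a periodic point, in the sense that no other orbit stays near it
  forever. Write \<open>F = f ^^ N\<close> and let \<open>\<Omega> m\<close> be the complement of the preimage of \<open>C\<close> under
  \<open>f ^^ m\<close>, so that the preimage of \<open>\<Omega> m\<close> under \<open>F\<close> is \<open>\<Omega> (m + N)\<close>.
  The neighbourhood \<open>W\<close> is chosen for a level \<open>k\<close> such that components of level at least \<open>k\<close> that
  meet \<open>W\<close> have closures free of other \<open>F\<close>-preimages of \<open>p\<close>, and such that \<open>p\<close> is in the closure of
  every component of level exactly \<open>k\<close> that meets \<open>W\<close>; the latter is possible because those
  components are finite in number. Suppose \<open>y\<close> and its first \<open>n\<close> images under \<open>F\<close> lie in \<open>W\<close>. The
  component of \<open>\<Omega> (k + n * N)\<close> containing \<open>y\<close> is mapped by \<open>F ^^ n\<close> onto a component of level \<open>k\<close>,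
  which has \<open>p\<close> in its closure. Going back one application of \<open>F\<close> at a time, the closure always
  contains a preimage of \<open>p\<close>, which can only be \<open>p\<close>. So \<open>y\<close> is joined to \<open>p\<close> by a single
  component of level \<open>k + n * N\<close>. If \<open>y\<close> is close to a point \<open>x\<close> other than \<open>p\<close>, expansion at \<open>x\<close>
  forbids this for large \<open>n\<close>.\<close>

lemma fixed_point_isolating_neighbourhood:
  assumes X: "compact_space X" "Hausdorff_space X" "locally_connected_space X"
    and f: "continuous_map X X f" "open_map X X f"
    and fib: "\<And>y. y \<in> topspace X \<Longrightarrow> finite {x \<in> topspace X. f x = y}"
    and C: "closedin X C" "finite (connected_components_of (subtopology X (topspace X - C)))"
      "\<And>U. \<lbrakk>openin X U; U \<subseteq> C\<rbrakk> \<Longrightarrow> U = {}"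
    and small: "\<And>x V. \<lbrakk>openin X V; x \<in> V\<rbrakk> \<Longrightarrow> \<exists>W m. openin X W \<and> x \<in> W \<and>
        (\<forall>n K. n \<ge> m \<longrightarrow> K \<in> connected_components_of
            (subtopology X (topspace X - {x \<in> topspace X. (f ^^ n) x \<in> C})) \<longrightarrow> K \<inter> W \<noteq> {} \<longrightarrow>
          X closure_of K \<subseteq> V)"
    and p: "p \<in> topspace X" "(f ^^ N) p = p" "N \<ge> 1"
  obtains W where "openin X W" "p \<in> W"
    "\<And>x. (\<And>n. ((f ^^ N) ^^ n) x \<in> W) \<Longrightarrow> x = p"
proof -
  define F where "F = f ^^ N"
  define \<Omega> where "\<Omega> m = {x \<in> topspace X. (f ^^ m) x \<in> topspace X - C}" for m
  note fm = continuous_open_map_funpow [OF f]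
  have fX: "(f ^^ m) x \<in> topspace X" if "x \<in> topspace X" for m x
    using fm(1) that by (auto simp: continuous_map_def)
  have F: "continuous_map X X F" "open_map X X F" unfolding F_def by (rule fm)+
  have \<Omega>_eq: "topspace X - {x \<in> topspace X. (f ^^ m) x \<in> C} = \<Omega> m" for m
    using fX unfolding \<Omega>_def by auto
  have FX: "F x \<in> topspace X" if "x \<in> topspace X" for x
    unfolding F_def using fX that by blast
  have \<Omega>_add: "\<Omega> (m + N) = {x \<in> topspace X. F x \<in> \<Omega> m}" for m
    using FX unfolding \<Omega>_def F_def by (auto simp: funpow_add)
  have openC: "openin X (topspace X - C)" using C(1) by blast
  have \<Omega>_open: "openin X (\<Omega> m)" for m
    unfolding \<Omega>_def using fm(1) openC openin_continuous_map_preimage by blast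
  have finfib: "finite {x \<in> topspace X. (f ^^ m) x = y}" if "y \<in> topspace X" for m y
  proof (rule finite_fibres_funpow [OF fib _ that])
    show "f ` topspace X \<subseteq> topspace X" using fX [of _ 1] by auto
  qed
  have fin_comps: "finite (connected_components_of (subtopology X (\<Omega> m)))" for m
    unfolding \<Omega>_def
    using finite_connected_components_of_preimage [OF X(1,3,2) fm openC C(2) finfib] .
  have \<Omega>_dense: "U \<inter> \<Omega> m \<noteq> {}" if "openin X U" "U \<noteq> {}" for U m
  proof
    assume "U \<inter> \<Omega> m = {}"
    then have "(f ^^ m) ` U \<subseteq> C"
      using that(1) fX openin_subset unfolding \<Omega>_def by fastforce
    moreover have "openin X ((f ^^ m) ` U)" using fm(2) that(1) by (simp add: open_map_def)
    ultimately show False using C(3) that(2) by blast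
  qed
  define V where "V = topspace X - ({x \<in> topspace X. F x = p} - {p})"
  have "openin X V" "p \<in> V"
  proof -
    have "closedin X ({x \<in> topspace X. F x = p} - {p})"
      using finfib [OF p(1), of N] X(2) unfolding F_def
      by (intro closedin_Hausdorff_finite) auto
    then show "openin X V" unfolding V_def by blast
    show "p \<in> V" unfolding V_def using p by blast
  qed
  from small [OF this] obtain W1 k where W1: "openin X W1" "p \<in> W1"
    and k: "\<And>n K. \<lbrakk>n \<ge> k; K \<in> connected_components_of (subtopology X (\<Omega> n)); K \<inter> W1 \<noteq> {}\<rbrakk>
        \<Longrightarrow> X closure_of K \<subseteq> V"
    unfolding \<Omega>_eq by blast
  define \<K> where "\<K> = {K \<in> connected_components_of (subtopology X (\<Omega> k)). p \<notin> X closure_of K}"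
  define W where "W = W1 - (\<Union>K\<in>\<K>. X closure_of K)"
  have "finite \<K>" unfolding \<K>_def using fin_comps by simp
  then have "closedin X (\<Union>K\<in>\<K>. X closure_of K)"
    by (intro closedin_Union) auto
  then have W: "openin X W" unfolding W_def using W1(1) by (simp add: openin_diff)
  have pW: "p \<in> W" unfolding W_def \<K>_def using W1 by blast
  have key: "p \<in> X closure_of K"
    if "\<And>j. j \<le> n \<Longrightarrow> (F ^^ j) y \<in> W" "y \<in> K"
      "K \<in> connected_components_of (subtopology X (\<Omega> (k + n * N)))" for n y K
    using that
  proof (induction n arbitrary: y K)
    case 0
    have "y \<in> W" using 0(1) [of 0] by simp
    moreover have "K \<subseteq> topspace X" using connected_components_of_subset [OF 0(3)] by auto
    ultimately have "K \<notin> \<K>" unfolding W_def using 0(2) closure_of_subset by blast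
    then show ?case unfolding \<K>_def using 0(3) by simp
  next
    case (Suc n)
    have K: "K \<in> connected_components_of (subtopology X {x \<in> topspace X. F x \<in> \<Omega> (k + n * N)})"
      using Suc.prems(3) \<Omega>_add [of "k + n * N"] by (simp add: algebra_simps)
    have KX: "K \<subseteq> topspace X" using connected_components_of_subset [OF K] by auto
    have "(F ^^ j) (F y) \<in> W" if "j \<le> n" for j
      using Suc.prems(1) [of "Suc j"] that by (simp add: funpow_swap1)
    moreover have "F ` K \<in> connected_components_of (subtopology X (\<Omega> (k + n * N)))"
      using open_map_image_component [OF X(1,3,2) F \<Omega>_open K] .
    ultimately have "p \<in> X closure_of (F ` K)"
      using Suc.IH Suc.prems(2) by blast
    moreover have "X closure_of (F ` K) \<subseteq> F ` (X closure_of K)"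
    proof (rule closure_of_minimal)
      show "F ` K \<subseteq> F ` (X closure_of K)" using closure_of_subset [OF KX] by blast
      show "closedin X (F ` (X closure_of K))"
        using continuous_imp_closed_map [OF F(1) X(1,2)] by (simp add: closed_map_def)
    qed
    ultimately obtain q where q: "q \<in> X closure_of K" "F q = p" by blast
    have "y \<in> W1" using Suc.prems(1) [of 0] unfolding W_def by simp
    then have "X closure_of K \<subseteq> V"
      using k [OF _ Suc.prems(3)] Suc.prems(2) by fastforce
    then have "q = p" using q unfolding V_def by blast
    then show ?case using q by simp
  qed
  show thesis
  proof (rule that [OF W pW])
    fix x assume orbit: "\<And>n. ((f ^^ N) ^^ n) x \<in> W"
    show "x = p"
    proof (rule ccontr)
      assume "x \<noteq> p"
      have "x \<in> topspace X" using orbit [of 0] W openin_subset by fastforce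
      then have "x \<in> topspace X - {p}" using \<open>x \<noteq> p\<close> by simp
      moreover have "openin X (topspace X - {p})"
        using X(2) p(1) by (simp add: closedin_Hausdorff_singleton openin_diff)
      ultimately obtain W2 n where W2: "openin X W2" "x \<in> W2"
        and n: "\<And>m K. \<lbrakk>m \<ge> n; K \<in> connected_components_of (subtopology X (\<Omega> m)); K \<inter> W2 \<noteq> {}\<rbrakk>
            \<Longrightarrow> X closure_of K \<subseteq> topspace X - {p}"
        using small unfolding \<Omega>_eq by meson
      \<comment> \<open>The point \<open>x\<close> itself may lie on a preimage of \<open>C\<close>, so it is replaced by a nearby \<open>y\<close>
        that lies in \<open>\<Omega> (k + n * N)\<close> and whose first \<open>n\<close> images still lie in \<open>W\<close>.\<close>
      define U where "U = W2 \<inter> (\<Inter>j\<le>n. {y \<in> topspace X. (F ^^ j) y \<in> W})"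
      have "openin X U"
        unfolding U_def
        by (intro openin_Int openin_INT2 W2(1) openin_continuous_map_preimage [OF _ W]
            continuous_open_map_funpow(1) [OF F]) auto
      moreover have "x \<in> U"
        unfolding U_def using W2 orbit \<open>x \<in> topspace X\<close> by (simp add: F_def)
      ultimately obtain y where y: "y \<in> U" "y \<in> \<Omega> (k + n * N)" using \<Omega>_dense by blast
      define K where "K = connected_component_of_set (subtopology X (\<Omega> (k + n * N))) y"
      have yt: "y \<in> topspace (subtopology X (\<Omega> (k + n * N)))"
        using y(2) unfolding \<Omega>_def by simp
      have K: "K \<in> connected_components_of (subtopology X (\<Omega> (k + n * N)))" and "y \<in> K"
        unfolding K_def using yt
        by (simp_all add: connected_component_in_connected_components_of connected_component_of_refl)
      have "p \<in> X closure_of K"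
        by (rule key [OF _ \<open>y \<in> K\<close> K]) (use y(1) in \<open>simp add: U_def\<close>)
      \<comment> \<open>This is where the number \<open>n\<close> of steps is large enough for expansion to apply at \<open>x\<close>.\<close>
      moreover have "k + n * N \<ge> n" using p(3) by (simp add: trans_le_add2)
      then have "X closure_of K \<subseteq> topspace X - {p}"
        using n [OF _ K] y(1) \<open>y \<in> K\<close> unfolding U_def by blast
      ultimately show False by blast
    qed
  qed
qed

lemma expanding_Thurston_map_isolating_neighbourhood:
  assumes X: "X homeomorphic_space top_of_set euclidean_2_sphere"
    and f: "expanding_Thurston_map X \<omega> f"
    and p: "p \<in> topspace X" "(f ^^ N) p = p" "N \<ge> 1"
  obtains W where "openin X W" "p \<in> W" "\<And>x. (\<And>n. ((f ^^ N) ^^ n) x \<in> W) \<Longrightarrow> x = p"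
proof -
  have cov: "branched_covering_map X \<omega> f"
    using f unfolding expanding_Thurston_map_def Thurston_map_def by blast
  then have cont: "continuous_map X X f" unfolding branched_covering_map_def by blast
  obtain d C where d: "Metric_space (topspace X) d" "Metric_space.mtopology (topspace X) d = X"
    and C: "Jordan_curve X C" and mesh: "(\<lambda>n. SUP T \<in> tiles X f C n. metric_diameter d T) \<longlonglongrightarrow> 0"
    using f unfolding expanding_Thurston_map_def by blast
  note top = sphere_2_topology [OF X]
  show thesis
  proof (rule fixed_point_isolating_neighbourhood [OF top cont branched_covering_map_open [OF cov]
        branched_covering_map_finite_fibres [OF cov top(1,2)] Jordan_curve_complement [OF X C] _ p])
    fix x V assume V: "openin X V" "x \<in> V"
    show "\<exists>W m. openin X W \<and> x \<in> W \<and> (\<forall>n K. n \<ge> m \<longrightarrow> K \<in> connected_components_of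
            (subtopology X (topspace X - {x \<in> topspace X. (f ^^ n) x \<in> C})) \<longrightarrow> K \<inter> W \<noteq> {} \<longrightarrow>
          X closure_of K \<subseteq> V)"
    proof (rule small_tiles_near_point [OF d top(1) mesh V])
      fix W m assume "openin X W" "x \<in> W"
        "\<And>n K. \<lbrakk>n \<ge> m; K \<in> connected_components_of
          (subtopology X (topspace X - {x \<in> topspace X. (f ^^ n) x \<in> C})); K \<inter> W \<noteq> {}\<rbrakk>
        \<Longrightarrow> X closure_of K \<subseteq> V"
      then show ?thesis by (intro exI conjI allI impI)
    qed
  qed (use that in blast)+
qed

section \<open>Arcs across an invariant cone\<close>

lemma continuous_first_zero:
  fixes g :: "real \<Rightarrow> real"
  assumes g: "continuous_on {a..b} g" and "a \<le> b" "g a \<ge> 0" "g b \<le> 0"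
  obtains c where "a \<le> c" "c \<le> b" "g c = 0" "\<And>t. t \<in> {a..c} \<Longrightarrow> g t \<ge> 0"
proof -
  define Z where "Z = {t \<in> {a..b}. g t = 0}"
  have zero: "\<exists>z\<in>Z. z \<le> t" if t: "t \<in> {a..b}" "g t \<le> 0" for t
  proof -
    have "continuous_on {a..t} g" using g t(1) by (auto intro: continuous_on_subset)
    then obtain z where "a \<le> z" "z \<le> t" "g z = 0"
      using IVT2' [of g t 0 a] assms(3) t by auto
    then show ?thesis unfolding Z_def using t(1) by auto
  qed
  have "closed Z" unfolding Z_def using continuous_closed_preimage_constant [OF g] by simp
  moreover have "Z \<noteq> {}" using zero [of b] assms by auto
  moreover have bdd: "bdd_below Z" unfolding Z_def by (auto intro: bdd_belowI [of _ a])
  ultimately have c: "Inf Z \<in> Z" using closed_contains_Inf by blast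
  show thesis
  proof (rule that [of "Inf Z"])
    fix t assume t: "t \<in> {a..Inf Z}"
    show "g t \<ge> 0"
    proof (rule ccontr)
      assume "\<not> g t \<ge> 0"
      moreover have "t \<in> {a..b}" using t c unfolding Z_def by auto
      ultimately obtain z where "z \<in> Z" "z \<le> t" using zero [of t] by auto
      then have "Inf Z \<le> t" using cInf_lower [OF _ bdd] by fastforce
      then have "t = Inf Z" using t by simp
      then show False using c \<open>\<not> g t \<ge> 0\<close> unfolding Z_def by simp
    qed
  qed (use c in \<open>auto simp: Z_def\<close>)
qed

text \<open>A path that starts above the band \<open>\<bar>f\<bar> \<le> q\<close> and ends below it contains a piece that stays in the
  band and joins its two edges: cut at the first time the lower edge is reached, then at the last
  time before it on the upper edge.\<close>

lemma subinterval_crossing: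
  fixes f q :: "real \<Rightarrow> real"
  assumes f: "continuous_on {a..b} f" and q: "continuous_on {a..b} q" "\<And>t. t \<in> {a..b} \<Longrightarrow> q t \<ge> 0"
    and "a \<le> b" "f a \<ge> q a" "f b \<le> - q b"
  obtains a' b' where "a \<le> a'" "a' \<le> b'" "b' \<le> b" "f a' = q a'" "f b' = - q b'"
    "\<And>t. t \<in> {a'..b'} \<Longrightarrow> \<bar>f t\<bar> \<le> q t"
proof -
  have "continuous_on {a..b} (\<lambda>t. f t + q t)" using f q by (intro continuous_intros)
  moreover have "q a \<ge> 0" using q(2) [of a] assms(4) by simp
  ultimately obtain b' where b': "a \<le> b'" "b' \<le> b" "f b' + q b' = 0"
    "\<And>t. t \<in> {a..b'} \<Longrightarrow> f t + q t \<ge> 0"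
    using continuous_first_zero [of a b "\<lambda>t. f t + q t"] assms(4-6) by auto
  have "continuous_on {-b'..-a} (\<lambda>t. q (-t) - f (-t))"
  proof (rule continuous_on_compose2 [of "{a..b}" "\<lambda>t. q t - f t" _ uminus])
    show "continuous_on {a..b} (\<lambda>t. q t - f t)" using f q by (intro continuous_intros)
    show "continuous_on {-b'..-a} uminus" by (intro continuous_intros)
    show "uminus ` {-b'..-a} \<subseteq> {a..b}" using b' by auto
  qed
  moreover have "q b' \<ge> 0" using q(2) b' by auto
  ultimately obtain c where c: "-b' \<le> c" "c \<le> -a" "q (-c) - f (-c) = 0"
    "\<And>t. t \<in> {-b'..c} \<Longrightarrow> q (-t) - f (-t) \<ge> 0"
    using continuous_first_zero [of "-b'" "-a" "\<lambda>t. q (-t) - f (-t)"] assms(5) b' by auto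
  show thesis
  proof (rule that [of "-c" b'])
    fix t assume t: "t \<in> {-c..b'}"
    then have "f t + q t \<ge> 0" using b'(4) c(2) by simp
    moreover have "q t - f t \<ge> 0" using c(4) [of "-t"] t by simp
    ultimately show "\<bar>f t\<bar> \<le> q t" by linarith
  qed (use b' c in auto)
qed

text \<open>The cone \<open>\<bar>s y\<bar> \<le> \<epsilon> * r y\<close> separates two sides, given by the sign of \<open>s\<close>, which \<open>G\<close> preserves if
  \<open>\<sigma> = 1\<close> and exchanges if \<open>\<sigma> = -1\<close>. As the arc \<open>c\<close> joins the two sides, a subarc crosses the cone
  from edge to edge; its image again joins the two sides, and the argument repeats.
  The parameter intervals obtained in this way are nested, and a common point \<open>t\<close> gives an orbit
  that stays in the cone forever. The set \<open>J n\<close>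
  consists of the parameters whose orbits are in the cone for \<open>n\<close> steps; the intervals themselves
  only serve to show that it is not empty.\<close>

lemma arc_across_cone_contains_trapped_point:
  fixes S :: "'a::real_normed_vector set" and G :: "'a \<Rightarrow> 'a" and s r :: "'a \<Rightarrow> real" and c :: "real \<Rightarrow> 'a"
  assumes G: "continuous_on S G" "G ` S \<subseteq> S"
    and s: "continuous_on S s" and r: "continuous_on S r" "\<And>y. r y \<ge> 0" and \<epsilon>: "\<epsilon> > 0"
    and cone: "\<And>y. \<lbrakk>y \<in> S; r y < R; \<bar>s y\<bar> \<le> \<epsilon> * r y\<rbrakk> \<Longrightarrow> r (G y) \<le> r y"
    and side: "\<And>y \<tau>. \<lbrakk>y \<in> S; r y < R; \<bar>\<tau>\<bar> = 1; \<tau> * s y \<ge> \<epsilon> * r y\<rbrakk>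
        \<Longrightarrow> \<tau> * \<sigma> * s (G y) \<ge> \<epsilon> * r (G y)"
    and \<sigma>: "\<bar>\<sigma>\<bar> = 1"
    and c: "continuous_on {0..1} c" "c ` {0..1} \<subseteq> S" "\<And>t. t \<in> {0..1} \<Longrightarrow> r (c t) < R"
    and ends: "s (c 0) \<ge> \<epsilon> * r (c 0)" "s (c 1) \<le> - \<epsilon> * r (c 1)"
  shows "\<exists>t\<in>{0..1}. \<forall>n. r ((G ^^ n) (c t)) < R"
proof -
  define x where "x n t = (G ^^ n) (c t)" for n t
  have xS: "x n t \<in> S" if "t \<in> {0..1}" for n t
  proof (induction n)
    case 0 show ?case using c(2) that unfolding x_def by auto
  next
    case (Suc n) then show ?case using G(2) unfolding x_def by auto
  qed
  have cont: "continuous_on {0..1} (x n)" for n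
  proof (induction n)
    case 0 show ?case using c(1) unfolding x_def by simp
  next
    case (Suc n)
    then have "continuous_on {0..1} (\<lambda>t. G (x n t))"
      using continuous_on_compose2 [OF G(1) Suc] xS by blast
    then show ?case unfolding x_def by simp
  qed
  have conts: "continuous_on {0..1} (\<lambda>t. s (x n t))" and contr: "continuous_on {0..1} (\<lambda>t. r (x n t))" for n
    using continuous_on_compose2 [OF s cont] continuous_on_compose2 [OF r(1) cont] xS by blast+
  define J where "J n = {t \<in> {0..1}. \<forall>k<n. \<bar>s (x k t)\<bar> \<le> \<epsilon> * r (x k t)}" for n
  have near: "r (x k t) < R" if "t \<in> J n" "k \<le> n" for n k t
    using that(2)
  proof (induction k)
    case 0 show ?case using c(3) that(1) unfolding J_def x_def by simp
  next
    case (Suc k)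
    then have "r (x k t) < R" by simp
    moreover have "x k t \<in> S" "\<bar>s (x k t)\<bar> \<le> \<epsilon> * r (x k t)"
      using that(1) Suc.prems xS unfolding J_def by auto
    ultimately have "r (G (x k t)) < R" using cone by fastforce
    then show ?case unfolding x_def by simp
  qed
  \<comment> \<open>The sign \<open>\<tau>\<close> records on which side the left end of the interval is after \<open>n\<close> steps.\<close>
  have ex: "\<exists>a b \<tau>. a \<le> b \<and> {a..b} \<subseteq> J n \<and> \<bar>\<tau>\<bar> = 1 \<and>
      \<tau> * s (x n a) \<ge> \<epsilon> * r (x n a) \<and> (-\<tau>) * s (x n b) \<ge> \<epsilon> * r (x n b)" for n
  proof (induction n)
    case 0
    show ?case
      by (rule exI [of _ 0], rule exI [of _ 1], rule exI [of _ 1]) (use ends in \<open>auto simp: J_def x_def\<close>)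
  next
    case (Suc n)
    then obtain a b \<tau> where ab: "a \<le> b" "{a..b} \<subseteq> J n" "\<bar>\<tau>\<bar> = 1"
      and ea: "\<tau> * s (x n a) \<ge> \<epsilon> * r (x n a)" and eb: "(-\<tau>) * s (x n b) \<ge> \<epsilon> * r (x n b)"
      by blast
    have sub: "{a..b} \<subseteq> {0..1}" using ab(2) unfolding J_def by blast
    obtain a' b' where a'b': "a \<le> a'" "a' \<le> b'" "b' \<le> b"
      "\<tau> * s (x n a') = \<epsilon> * r (x n a')" "\<tau> * s (x n b') = - (\<epsilon> * r (x n b'))"
      "\<And>t. t \<in> {a'..b'} \<Longrightarrow> \<bar>\<tau> * s (x n t)\<bar> \<le> \<epsilon> * r (x n t)"
    proof (rule subinterval_crossing [of a b "\<lambda>t. \<tau> * s (x n t)" "\<lambda>t. \<epsilon> * r (x n t)"])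
      show "continuous_on {a..b} (\<lambda>t. \<tau> * s (x n t))"
        using continuous_on_subset [OF conts sub] by (intro continuous_intros)
      show "continuous_on {a..b} (\<lambda>t. \<epsilon> * r (x n t))"
        using continuous_on_subset [OF contr sub] by (intro continuous_intros)
    qed (use r(2) \<epsilon> ab ea eb in auto)
    have J: "{a'..b'} \<subseteq> J (Suc n)"
    proof
      fix t assume t: "t \<in> {a'..b'}"
      then have "t \<in> J n" using ab(2) a'b'(1,3) by auto
      moreover have "\<bar>s (x n t)\<bar> \<le> \<epsilon> * r (x n t)"
        using a'b'(6) [OF t] ab(3) by (simp add: abs_mult)
      ultimately show "t \<in> J (Suc n)" unfolding J_def by (auto simp: less_Suc_eq)
    qed
    have a'J: "a' \<in> J n" "b' \<in> J n" using ab(2) a'b'(1-3) by auto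
    then have 01: "a' \<in> {0..1}" "b' \<in> {0..1}" unfolding J_def by auto
    have "\<tau> * \<sigma> * s (G (x n a')) \<ge> \<epsilon> * r (G (x n a'))"
      by (rule side) (use a'J near 01 xS ab a'b'(4) in auto)
    moreover have "(-\<tau>) * \<sigma> * s (G (x n b')) \<ge> \<epsilon> * r (G (x n b'))"
      by (rule side) (use a'J near 01 xS ab a'b'(5) in auto)
    ultimately have "a' \<le> b' \<and> {a'..b'} \<subseteq> J (Suc n) \<and> \<bar>\<tau> * \<sigma>\<bar> = 1 \<and>
      (\<tau> * \<sigma>) * s (x (Suc n) a') \<ge> \<epsilon> * r (x (Suc n) a') \<and>
      (-(\<tau> * \<sigma>)) * s (x (Suc n) b') \<ge> \<epsilon> * r (x (Suc n) b')"
      using J a'b'(2) ab(3) \<sigma> unfolding x_def by (simp add: abs_mult)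
    then show ?case by blast
  qed
  have "\<Inter> (range J) \<noteq> {}"
  proof (rule compact_nest)
    fix n
    have "closed {t \<in> {0..1}. \<bar>s (x k t)\<bar> - \<epsilon> * r (x k t) \<in> {..0}}" for k
    proof -
      have "continuous_on {0..1} (\<lambda>t. \<bar>s (x k t)\<bar> - \<epsilon> * r (x k t))"
        by (intro continuous_intros conts contr)
      from continuous_closed_preimage [OF this, of "{..0}"] show ?thesis
        by (simp add: vimage_def Int_def)
    qed
    then have "compact ({0..1} \<inter> (\<Inter>k\<in>{..<n}. {t \<in> {0..1}. \<bar>s (x k t)\<bar> - \<epsilon> * r (x k t) \<in> {..0}}))"
      by (intro compact_Int_closed closed_INT) auto
    moreover have "J n = {0..1} \<inter> (\<Inter>k\<in>{..<n}. {t \<in> {0..1}. \<bar>s (x k t)\<bar> - \<epsilon> * r (x k t) \<in> {..0}})"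
      unfolding J_def by auto
    ultimately show "compact (J n)" by simp
    show "J n \<noteq> {}" using ex [of n] by fastforce
    show "J n \<subseteq> J m" if "m \<le> n" for m
      using that unfolding J_def by auto
  qed
  then obtain t where "\<And>n. t \<in> J n" by blast
  then show ?thesis using near [of t n n for n] unfolding x_def J_def by blast
qed

section \<open>Degenerate fixed points on the sphere\<close>

text \<open>If no tangent vector at \<open>p\<close> were killed by the derivative of \<open>F\<close>, the map \<open>y \<mapsto> (F y, y \<bullet> y)\<close>
  would have an injective derivative at \<open>p\<close> and so would be injective near \<open>p\<close>. Its second
  component is constant on the sphere, so \<open>F\<close> would be injective on the sphere near \<open>p\<close>. Adding that
  component avoids charts of the sphere.\<close>

lemma not_injective_on_sphere_imp_tangent_kernel:
  fixes F :: "'a::euclidean_space \<Rightarrow> 'b::euclidean_space"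
  assumes U: "open U" "p \<in> U" and C1: "C_on 1 F U"
    and noninj: "\<And>W. \<lbrakk>open W; p \<in> W\<rbrakk> \<Longrightarrow> \<not> inj_on F (W \<inter> sphere 0 (norm p))"
  obtains v where "v \<noteq> 0" "v \<bullet> p = 0" "frechet_derivative F (at p) v = 0"
proof -
  define H where "H y = (F y, y \<bullet> y)" for y
  define H' where "H' y = (\<lambda>v. (frechet_derivative F (at y) v, 2 * (y \<bullet> v)))" for y
  have H: "(H has_derivative H' y) (at y)" if "y \<in> U" for y
  proof -
    have "(F has_derivative frechet_derivative F (at y)) (at y)"
      using C1 that by (simp add: frechet_derivative_works)
    then show ?thesis
      unfolding H_def H'_def
      by (auto intro!: derivative_eq_intros simp: inner_commute)
  qed
  have lin: "linear (H' p)" using H [OF U(2)] has_derivative_linear by blast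
  have "\<not> inj (H' p)"
  proof
    assume "inj (H' p)"
    then obtain L where L: "linear L" "L \<circ> H' p = id"
      using linear_injective_left_inverse [OF lin] by blast
    have "\<exists>d>0. \<forall>x. dist p x < d \<longrightarrow> onorm (\<lambda>v. H' x v - H' p v) < e" if "e > 0" for e
    proof -
      have tend: "((\<lambda>x. \<Sum>i\<in>Basis. norm (H' x i - H' p i)) \<longlongrightarrow> 0) (at p)"
      proof (rule tendsto_null_sum)
        fix i :: 'a
        have "continuous_on U (\<lambda>x. frechet_derivative F (at x) i)" using C1 by simp
        then have "isCont (\<lambda>x. frechet_derivative F (at x) i) p"
          using U continuous_on_eq_continuous_at by blast
        then have "isCont (\<lambda>x. H' x i) p"
          unfolding H'_def by (intro continuous_intros)
        then have "((\<lambda>x. H' x i) \<longlongrightarrow> H' p i) (at p)" by (simp add: isCont_def)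
        then show "((\<lambda>x. norm (H' x i - H' p i)) \<longlongrightarrow> 0) (at p)"
          using tendsto_norm_zero Lim_null by blast
      qed
      have "\<forall>\<^sub>F x in at p. (\<Sum>i\<in>Basis. norm (H' x i - H' p i)) < e \<and> x \<in> U"
        using order_tendstoD(2) [OF tend \<open>e > 0\<close>] eventually_at_in_open' [OF U]
        by (rule eventually_conj)
      then obtain d where d: "d > 0"
        "\<And>x. \<lbrakk>x \<noteq> p; dist x p < d\<rbrakk> \<Longrightarrow> (\<Sum>i\<in>Basis. norm (H' x i - H' p i)) < e \<and> x \<in> U"
        unfolding eventually_at by blast
      have "onorm (\<lambda>v. H' x v - H' p v) < e" if "dist p x < d" for x
      proof (cases "x = p")
        case True
        then show ?thesis using \<open>e > 0\<close> by (simp add: onorm_zero)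
      next
        case False
        then have x: "(\<Sum>i\<in>Basis. norm (H' x i - H' p i)) < e" "x \<in> U"
          using d(2) [of x] that by (auto simp: dist_commute)
        have "bounded_linear (\<lambda>v. H' x v - H' p v)"
          using has_derivative_bounded_linear [OF H [OF x(2)]] has_derivative_bounded_linear [OF H [OF U(2)]]
          by (rule bounded_linear_sub)
        then show ?thesis using le_less_trans [OF onorm_componentwise x(1)] by blast
      qed
      then show ?thesis using d(1) by blast
    qed
    note small = this
    obtain \<rho> where \<rho>: "\<rho> > 0" "inj_on H (ball p \<rho>)"
    proof (rule has_derivative_locally_injective [of p U L H' H])
      show "bounded_linear L" using L(1) by (simp add: linear_conv_bounded_linear)
      show "L \<circ> H' p = id" by (rule L(2))
      show "\<exists>d>0. \<forall>x. dist p x < d \<longrightarrow> onorm (\<lambda>v. H' x v - H' p v) < e" if "e > 0" for e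
        using that by (rule small)
    qed (use U H in blast)+
    have "inj_on F (ball p \<rho> \<inter> sphere 0 (norm p))"
    proof (rule inj_onI)
      fix y z assume *: "y \<in> ball p \<rho> \<inter> sphere 0 (norm p)" "z \<in> ball p \<rho> \<inter> sphere 0 (norm p)" "F y = F z"
      then have "H y = H z" unfolding H_def by (simp add: dot_square_norm)
      then show "y = z" using \<rho>(2) * by (meson IntD1 inj_onD)
    qed
    then show False using noninj [of "ball p \<rho>"] \<rho>(1) by simp
  qed
  then obtain v where "v \<noteq> 0" "H' p v = 0"
    using lin linear_injective_0 by blast
  then show thesis using that [of v] unfolding H'_def by (simp add: zero_prod_def inner_commute)
qed

lemma orthonormal_expansion_cross3:
  fixes p v y :: "real^3"
  assumes "norm p = 1" "norm v = 1" "v \<bullet> p = 0"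
  defines "w \<equiv> cross3 p v"
  shows "norm w = 1" "w \<bullet> p = 0" "w \<bullet> v = 0"
    "y = (y \<bullet> p) *\<^sub>R p + (y \<bullet> v) *\<^sub>R v + (y \<bullet> w) *\<^sub>R w"
proof -
  show w: "w \<bullet> p = 0" "w \<bullet> v = 0" unfolding w_def by (simp_all add: dot_cross_self)
  have "(norm w)\<^sup>2 = 1"
    using norm_cross_dot [of p v] assms by (simp add: inner_commute)
  then show "norm w = 1" by (simp add: power2_eq_1_iff) (smt (verit) norm_ge_zero)
  define z where "z = y - ((y \<bullet> p) *\<^sub>R p + (y \<bullet> v) *\<^sub>R v + (y \<bullet> w) *\<^sub>R w)"
  have "p \<bullet> p = 1" "v \<bullet> v = 1" "w \<bullet> w = 1"
    using assms \<open>norm w = 1\<close> by (simp_all add: dot_square_norm)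
  moreover have "v \<bullet> p = 0" "p \<bullet> v = 0" "p \<bullet> w = 0" "v \<bullet> w = 0"
    using assms(3) w by (simp_all add: inner_commute)
  ultimately have z: "z \<bullet> p = 0" "z \<bullet> v = 0" "z \<bullet> w = 0"
    unfolding z_def using w by (simp_all add: inner_diff_left inner_add_left)
  have "cross3 z w = 0" unfolding w_def Lagrange using z by simp
  moreover have "w \<noteq> 0" using \<open>norm w = 1\<close> by auto
  ultimately have "z = 0" using norm_and_cross_eq_0 [of z w] z(3) by blast
  then show "y = (y \<bullet> p) *\<^sub>R p + (y \<bullet> v) *\<^sub>R v + (y \<bullet> w) *\<^sub>R w" unfolding z_def by simp
qed

text \<open>The tangent plane at \<open>p\<close> is spanned by \<open>v\<close> and \<open>w\<close>, and \<open>A\<close> kills \<open>v\<close>; the component of \<open>y - p\<close>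
  along the normal \<open>p\<close> is quadratically small on the sphere. To first order \<open>G\<close> therefore depends
  only on the coordinate \<open>y \<bullet> w\<close>.\<close>

lemma degenerate_fixed_point_expansion:
  fixes G :: "real^3 \<Rightarrow> real^3"
  assumes p: "norm p = 1" "G p = p" and A: "(G has_derivative A) (at p within sphere 0 1)"
    and v: "norm v = 1" "v \<bullet> p = 0" "A v = 0"
  defines "w \<equiv> cross3 p v"
  assumes \<delta>: "\<delta> > 0"
  obtains \<rho> where "\<rho> > 0" "\<And>y. \<lbrakk>y \<in> sphere 0 1; norm (y - p) < \<rho>\<rbrakk> \<Longrightarrow>
    norm (G y - p - (y \<bullet> w) *\<^sub>R A w) \<le> \<delta> * norm (y - p)"
proof -
  have linA: "linear A" using A has_derivative_linear by blast
  obtain d where d: "d > 0" "\<And>y. \<lbrakk>y \<in> sphere 0 1; norm (y - p) < d\<rbrakk> \<Longrightarrow>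
      norm (G y - G p - A (y - p)) \<le> \<delta> / 2 * norm (y - p)"
    using A \<delta> unfolding has_derivative_within_alt by (metis half_gt_zero)
  define \<rho> where "\<rho> = min d (\<delta> / (norm (A p) + 1))"
  have pos: "norm (A p) + 1 > 0" by (smt (verit) norm_ge_zero)
  show thesis
  proof (rule that [of \<rho>])
    show "\<rho> > 0" unfolding \<rho>_def using d \<delta> pos by simp
    fix y :: "real^3" assume y: "y \<in> sphere 0 1" "norm (y - p) < \<rho>"
    define r where "r = norm (y - p)"
    \<comment> \<open>The normal component of \<open>y - p\<close> is \<open>- (r\<^sup>2 / 2)\<close> because \<open>y\<close> and \<open>p\<close>
      are unit vectors.\<close>
    have "r\<^sup>2 = 2 - 2 * (y \<bullet> p)"
      using y(1) p(1) unfolding r_def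
      by (simp add: power2_norm_eq_inner inner_diff inner_commute norm_eq_1)
    then have yp: "(y - p) \<bullet> p = - (r\<^sup>2 / 2)"
      using p(1) by (simp add: inner_diff_left norm_eq_1 field_simps)
    note w = orthonormal_expansion_cross3 [OF p(1) v(1,2), folded w_def]
    have "(y - p) \<bullet> w = y \<bullet> w" using w(2) by (simp add: inner_diff_left inner_commute [of p w])
    then have "y - p = (- (r\<^sup>2 / 2)) *\<^sub>R p + ((y - p) \<bullet> v) *\<^sub>R v + (y \<bullet> w) *\<^sub>R w"
      using w(4) [of "y - p"] yp by simp
    then have "A (y - p) = A ((- (r\<^sup>2 / 2)) *\<^sub>R p + ((y - p) \<bullet> v) *\<^sub>R v + (y \<bullet> w) *\<^sub>R w)" by simp
    also have "\<dots> = (- (r\<^sup>2 / 2)) *\<^sub>R A p + (y \<bullet> w) *\<^sub>R A w"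
      using v(3) by (simp add: linear_add [OF linA] linear_scale [OF linA] linear_diff [OF linA] linear_neg [OF linA] del: scaleR_minus_left)
    finally have Ay: "A (y - p) = (- (r\<^sup>2 / 2)) *\<^sub>R A p + (y \<bullet> w) *\<^sub>R A w" .
    have "r * norm (A p) \<le> r * (norm (A p) + 1)" unfolding r_def by (simp add: mult_left_mono)
    also have "\<dots> \<le> \<delta>"
      using y(2) pos unfolding \<rho>_def r_def by (simp add: field_simps)
    finally have "r * (r * norm (A p)) \<le> r * \<delta>"
      unfolding r_def by (rule mult_left_mono) simp
    then have small: "norm ((- (r\<^sup>2 / 2)) *\<^sub>R A p) \<le> \<delta> / 2 * r"
      by (simp add: power2_eq_square field_simps)
    have "G y - p - (y \<bullet> w) *\<^sub>R A w = (G y - G p - A (y - p)) + (- (r\<^sup>2 / 2)) *\<^sub>R A p"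
      unfolding Ay using p(2) by simp
    then have "norm (G y - p - (y \<bullet> w) *\<^sub>R A w) \<le>
        norm (G y - G p - A (y - p)) + norm ((- (r\<^sup>2 / 2)) *\<^sub>R A p)"
      by (metis norm_triangle_ineq)
    also have "\<dots> \<le> \<delta> / 2 * r + \<delta> / 2 * r"
      using d(2) [OF y(1)] y(2) small unfolding \<rho>_def r_def by (intro add_mono) auto
    finally show "norm (G y - p - (y \<bullet> w) *\<^sub>R A w) \<le> \<delta> * norm (y - p)"
      unfolding r_def by simp
  qed
qed

text \<open>A differentiable self-map of the sphere that fixes \<open>p\<close> with a derivative killing a tangent vector
  cannot repel every point from \<open>p\<close>. In the notation of the proof, \<open>G y - p\<close> is \<open>s y\<close> times a fixed
  vector \<open>u\<close> up to an error that is small compared with \<open>r y = norm (y - p)\<close>, and \<open>\<mu>\<close> is the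
  eigenvalue of the derivative complementary to the eigenvalue \<open>0\<close>.
  If \<open>\<mu> = 0\<close>, the derivative is nilpotent on the tangent plane, and
  \<open>m y = r y + norm u * \<bar>s y\<bar>\<close> does not increase along orbits near \<open>p\<close>, so all points near \<open>p\<close> remain near \<open>p\<close>. If \<open>\<mu> \<noteq> 0\<close>, the two sides of a thin cone
  \<open>\<bar>s y\<bar> \<le> \<epsilon> * r y\<close> around the kernel direction are preserved or exchanged according to the sign of
  \<open>\<mu>\<close>, and inside the cone \<open>r\<close> does not increase. A half circle \<open>c\<close> on the sphere that passes
  around \<open>p\<close> from one side to the other then contains a trapped point.\<close>

lemma degenerate_fixed_point_traps_nearby_point:
  fixes G :: "real^3 \<Rightarrow> real^3"
  assumes G: "continuous_on (sphere 0 1) G" "G ` sphere 0 1 \<subseteq> sphere 0 1"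
    and p: "norm p = 1" "G p = p" and A: "(G has_derivative A) (at p within sphere 0 1)"
    and v: "v \<noteq> 0" "v \<bullet> p = 0" "A v = 0"
    and R: "R > 0"
  obtains x where "x \<in> sphere 0 1" "x \<noteq> p" "\<And>n. norm ((G ^^ n) x - p) < R"
proof -
  define v1 where "v1 = v /\<^sub>R norm v"
  have linA: "linear A" using A has_derivative_linear by blast
  have v1: "norm v1 = 1" "v1 \<bullet> p = 0" "A v1 = 0"
    using v unfolding v1_def by (simp_all add: linear_scale [OF linA])
  define w where "w = cross3 p v1"
  define u where "u = A w"
  define \<mu> where "\<mu> = u \<bullet> w"
  define s where "s y = y \<bullet> w" for y
  define r where "r y = norm (y - p)" for y
  note w = orthonormal_expansion_cross3(1-3) [OF p(1) v1(1,2), folded w_def]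
  have [simp]: "p \<bullet> p = 1" "v1 \<bullet> v1 = 1" "w \<bullet> w = 1" "v1 \<bullet> p = 0" "w \<bullet> p = 0" "w \<bullet> v1 = 0"
    using p(1) v1 w by (simp_all add: norm_eq_1)
  have [simp]: "p \<bullet> v1 = 0" "p \<bullet> w = 0" "v1 \<bullet> w = 0"
    by (subst inner_commute, simp)+
  have expansion: "\<exists>\<rho>>0. \<forall>y\<in>sphere 0 1. r y < \<rho> \<longrightarrow>
      r (G y) \<le> norm u * \<bar>s y\<bar> + \<delta> * r y \<and> \<bar>s (G y) - \<mu> * s y\<bar> \<le> \<delta> * r y"
    if \<delta>: "\<delta> > 0" for \<delta>
  proof -
    obtain \<rho> where \<rho>: "\<rho> > 0" "\<And>y. \<lbrakk>y \<in> sphere 0 1; norm (y - p) < \<rho>\<rbrakk> \<Longrightarrow>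
        norm (G y - p - (y \<bullet> w) *\<^sub>R A w) \<le> \<delta> * norm (y - p)"
      using degenerate_fixed_point_expansion [OF p A v1 \<delta>, folded w_def] by blast
    have "r (G y) \<le> norm u * \<bar>s y\<bar> + \<delta> * r y \<and> \<bar>s (G y) - \<mu> * s y\<bar> \<le> \<delta> * r y"
      if y: "y \<in> sphere 0 1" "r y < \<rho>" for y
    proof
      define E where "E = G y - p - s y *\<^sub>R u"
      have E: "norm E \<le> \<delta> * r y"
        using \<rho>(2) [OF y [unfolded r_def]] unfolding E_def s_def u_def r_def .
      have eq: "G y - p = s y *\<^sub>R u + E" unfolding E_def by simp
      have "r (G y) \<le> norm (s y *\<^sub>R u) + norm E" unfolding r_def eq by (rule norm_triangle_ineq)
      then show "r (G y) \<le> norm u * \<bar>s y\<bar> + \<delta> * r y" using E by (simp add: mult.commute)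
      have "E \<bullet> w = s (G y) - \<mu> * s y"
        unfolding E_def s_def \<mu>_def by (simp add: inner_diff_left)
      then have "\<bar>s (G y) - \<mu> * s y\<bar> \<le> norm E"
        using Cauchy_Schwarz_ineq2 [of E w] w(1) by simp
      then show "\<bar>s (G y) - \<mu> * s y\<bar> \<le> \<delta> * r y" using E by simp
    qed
    then show ?thesis using \<rho>(1) by blast
  qed
  define c where "c \<kappa> t = sqrt (1 - \<kappa>\<^sup>2) *\<^sub>R p + (\<kappa> * cos (pi * t)) *\<^sub>R w + (\<kappa> * sin (pi * t)) *\<^sub>R v1"
    for \<kappa> t :: real
  have c: "c \<kappa> t \<in> sphere 0 1" "c \<kappa> t \<noteq> p" "r (c \<kappa> t) \<le> 2 * \<kappa>" "s (c \<kappa> t) = \<kappa> * cos (pi * t)"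
    if \<kappa>: "0 < \<kappa>" "\<kappa> < 1" for \<kappa> t
  proof -
    have k2: "0 < \<kappa>\<^sup>2" "\<kappa>\<^sup>2 < 1" using \<kappa> by (auto simp: power_less_one_iff abs_square_less_1)
    have "c \<kappa> t \<bullet> c \<kappa> t = (sqrt (1 - \<kappa>\<^sup>2))\<^sup>2 + (\<kappa> * cos (pi * t))\<^sup>2 + (\<kappa> * sin (pi * t))\<^sup>2"
      unfolding c_def by (simp add: inner_add_left inner_add_right power2_eq_square del: real_sqrt_mult_self)
    also have "\<dots> = 1 - \<kappa>\<^sup>2 + \<kappa>\<^sup>2 * ((cos (pi * t))\<^sup>2 + (sin (pi * t))\<^sup>2)"
      using k2 by (simp only: power_mult_distrib distrib_left real_sqrt_pow2 diff_ge_0_iff_ge less_imp_le)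
    finally have cc: "c \<kappa> t \<bullet> c \<kappa> t = 1" by simp
    then show "c \<kappa> t \<in> sphere 0 1" by (simp add: norm_eq_1)
    have cp: "c \<kappa> t \<bullet> p = sqrt (1 - \<kappa>\<^sup>2)"
      unfolding c_def by (simp add: inner_add_left)
    have "sqrt (1 - \<kappa>\<^sup>2) < 1" using k2 by simp
    moreover have "p \<bullet> p = 1" by simp
    ultimately show "c \<kappa> t \<noteq> p" using cp by (metis less_irrefl)
    have "1 - \<kappa>\<^sup>2 \<le> sqrt (1 - \<kappa>\<^sup>2)"
      using k2 by (intro real_le_rsqrt) (auto simp: power2_eq_square mult_le_cancel_left1)
    moreover have "(r (c \<kappa> t))\<^sup>2 = 2 - 2 * sqrt (1 - \<kappa>\<^sup>2)"
      unfolding r_def power2_norm_eq_inner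
      by (simp add: inner_diff_left inner_diff_right cc cp inner_commute [of p "c \<kappa> t"])
    ultimately have "(r (c \<kappa> t))\<^sup>2 \<le> 2 * \<kappa>\<^sup>2" by linarith
    also have "\<dots> \<le> (2 * \<kappa>)\<^sup>2" using k2 by (simp add: power_mult_distrib)
    finally show "r (c \<kappa> t) \<le> 2 * \<kappa>" by (rule power2_le_imp_le) (use \<kappa> in simp)
    show "s (c \<kappa> t) = \<kappa> * cos (pi * t)" unfolding s_def c_def by (simp add: inner_add_left)
  qed
  have r0: "r y \<ge> 0" for y unfolding r_def by simp
  show thesis
  proof (cases "\<mu> = 0")
    case True
    define U where "U = norm u"
    have U: "U \<ge> 0" unfolding U_def by simp
    obtain \<rho> where \<rho>: "\<rho> > 0" "\<And>y. \<lbrakk>y \<in> sphere 0 1; r y < \<rho>\<rbrakk> \<Longrightarrow>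
        r (G y) \<le> U * \<bar>s y\<bar> + 1 / (1 + U) * r y \<and> \<bar>s (G y)\<bar> \<le> 1 / (1 + U) * r y"
      using expansion [of "1 / (1 + U)"] U True unfolding U_def by auto
    define m where "m y = r y + U * \<bar>s y\<bar>" for y
    have step: "m (G y) \<le> m y" if y: "y \<in> sphere 0 1" "r y < \<rho>" for y
    proof -
      have "m (G y) \<le> (U * \<bar>s y\<bar> + 1 / (1 + U) * r y) + U * (1 / (1 + U) * r y)"
        unfolding m_def using \<rho>(2) [OF y] U by (intro add_mono mult_left_mono) auto
      also have "\<dots> = (1 + U) * (1 / (1 + U)) * r y + U * \<bar>s y\<bar>"
        by (simp only: ring_distribs mult_1_left mult_1_right mult.assoc add_ac)
      also have "\<dots> = m y" unfolding m_def using U by simp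
      finally show ?thesis .
    qed
    define R0 where "R0 = min R \<rho>"
    define \<kappa> where "\<kappa> = min (1/2) (R0 / (2 * (2 + U)))"
    have R0: "R0 > 0" unfolding R0_def using R \<rho> by simp
    have \<kappa>: "0 < \<kappa>" "\<kappa> < 1" unfolding \<kappa>_def using R0 U by auto
    define x where "x = c \<kappa> 0"
    have "m x \<le> 2 * \<kappa> + U * \<kappa>"
      unfolding m_def x_def using c(3,4) [OF \<kappa>, of 0] \<kappa> by simp
    also have "\<dots> = \<kappa> * (2 + U)" by (simp add: algebra_simps)
    also have "\<dots> \<le> (R0 / (2 * (2 + U))) * (2 + U)"
      unfolding \<kappa>_def using U by (intro mult_right_mono) auto
    also have "\<dots> = R0 / 2" using U by (simp add: field_simps)
    also have "\<dots> < R0" using R0 by simp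
    finally have mx: "m x < R0" .
    have orbit: "(G ^^ n) x \<in> sphere 0 1 \<and> m ((G ^^ n) x) < R0" for n
    proof (induction n)
      case 0 show ?case using c(1) [OF \<kappa>] mx unfolding x_def by simp
    next
      case (Suc n)
      then have "r ((G ^^ n) x) < R0" unfolding m_def using U by (smt (verit) mult_nonneg_nonneg abs_ge_zero)
      then have "m (G ((G ^^ n) x)) < R0"
        using Suc step [of "(G ^^ n) x"] unfolding R0_def by auto
      moreover have "G ((G ^^ n) x) \<in> sphere 0 1" using Suc G(2) by blast
      ultimately show ?case by simp
    qed
    show thesis
    proof (rule that [of x])
      show "norm ((G ^^ n) x - p) < R" for n
        using orbit [of n] U mult_nonneg_nonneg [OF U abs_ge_zero, of "s ((G ^^ n) x)"]
        unfolding m_def r_def R0_def by linarith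
    qed (use c(1,2) [OF \<kappa>] in \<open>auto simp: x_def\<close>)
  next
    case False
    define U where "U = norm u"
    have lamU: "\<bar>\<mu>\<bar> \<le> U"
      unfolding \<mu>_def U_def using Cauchy_Schwarz_ineq2 [of u w] w(1) by simp
    then have U: "U > 0" using False by simp
    \<comment> \<open>The cone must be so thin that \<open>u\<close> cannot push its points away from \<open>p\<close>, and that \<open>u\<close>
      itself, whose \<open>w\<close>-component is \<open>\<mu>\<close> and whose length is \<open>U\<close>, lies well outside it;
      \<open>\<delta>\<close> makes the error small compared with \<open>s\<close> outside the cone.\<close>
    define \<epsilon> where "\<epsilon> = min (1/2) (min (1 / (2 * U)) (\<bar>\<mu>\<bar> / (4 * U)))"
    define \<delta> where "\<delta> = \<epsilon> * \<bar>\<mu>\<bar> / 4"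
    define \<delta>' where "\<delta>' = min (1/2) \<delta>"
    have \<epsilon>: "\<epsilon> > 0" "\<epsilon> \<le> 1/2" unfolding \<epsilon>_def using U False by auto
    have "\<epsilon> * U \<le> \<bar>\<mu>\<bar> / (4 * U) * U" "\<epsilon> * U \<le> 1 / (2 * U) * U"
      unfolding \<epsilon>_def using U by (intro mult_right_mono; simp)+
    then have \<epsilon>U: "\<epsilon> * U \<le> \<bar>\<mu>\<bar> / 4" "\<epsilon> * U \<le> 1 / 2" using U by simp_all
    have \<delta>: "\<delta>' > 0" "\<delta>' \<le> 1/2" "\<delta>' \<le> \<delta>" unfolding \<delta>'_def \<delta>_def using \<epsilon> False by auto
    obtain \<rho> where \<rho>: "\<rho> > 0" "\<And>y. \<lbrakk>y \<in> sphere 0 1; r y < \<rho>\<rbrakk> \<Longrightarrow>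
        r (G y) \<le> U * \<bar>s y\<bar> + \<delta>' * r y \<and> \<bar>s (G y) - \<mu> * s y\<bar> \<le> \<delta>' * r y"
      using expansion [OF \<delta>(1)] unfolding U_def by auto
    define R0 where "R0 = min R \<rho>"
    define \<kappa> where "\<kappa> = min (1/2) (R0 / 4)"
    have R0: "R0 > 0" unfolding R0_def using R \<rho> by simp
    have \<kappa>: "0 < \<kappa>" "\<kappa> < 1" unfolding \<kappa>_def using R0 by auto
    have "\<exists>t\<in>{0..1}. \<forall>n. r ((G ^^ n) (c \<kappa> t)) < R0"
    proof (rule arc_across_cone_contains_trapped_point [OF G, of s r \<epsilon> R0 "sgn \<mu>"])
      show "continuous_on (sphere 0 1) s" "continuous_on (sphere 0 1) r"
        unfolding s_def r_def by (intro continuous_intros)+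
      show "r y \<ge> 0" "\<epsilon> > 0" "\<bar>sgn \<mu>\<bar> = 1" for y using r0 \<epsilon> False by (auto simp: abs_sgn_eq)
    next
      fix y assume y: "y \<in> sphere 0 1" "r y < R0" "\<bar>s y\<bar> \<le> \<epsilon> * r y"
      have "r (G y) \<le> U * \<bar>s y\<bar> + \<delta>' * r y" using \<rho>(2) y unfolding R0_def by simp
      also have "\<dots> \<le> U * (\<epsilon> * r y) + \<delta>' * r y" using y(3) U by (simp add: mult_left_mono)
      also have "\<dots> = (\<epsilon> * U + \<delta>') * r y" by (simp add: algebra_simps)
      also have "\<dots> \<le> 1 * r y"
      proof (rule mult_right_mono)
        show "\<epsilon> * U + \<delta>' \<le> 1" using \<epsilon>U(2) \<delta>(2) by linarith
      qed (rule r0)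
      finally show "r (G y) \<le> r y" by simp
    next
      fix y :: "real^3" and \<tau> :: real
      assume y: "y \<in> sphere 0 1" "r y < R0" and \<tau>: "\<bar>\<tau>\<bar> = 1" "\<tau> * s y \<ge> \<epsilon> * r y"
      have "\<tau> * s y \<ge> 0" using \<tau>(2) \<epsilon>(1) r0 [of y] by (meson less_imp_le mult_nonneg_nonneg order_trans)
      then have abs: "\<bar>s y\<bar> = \<tau> * s y" using \<tau>(1) by (metis abs_mult abs_of_nonneg mult_1)
      have Gy: "r (G y) \<le> U * \<bar>s y\<bar> + \<delta>' * r y" "\<bar>s (G y) - \<mu> * s y\<bar> \<le> \<delta>' * r y"
        using \<rho>(2) y unfolding R0_def by simp_all
      have "\<delta>' * r y \<le> \<delta> * r y" using \<delta>(3) r0 by (rule mult_right_mono)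
      also have "\<dots> = \<bar>\<mu>\<bar> / 4 * (\<epsilon> * r y)" unfolding \<delta>_def by simp
      also have "\<dots> \<le> \<bar>\<mu>\<bar> / 4 * \<bar>s y\<bar>" using \<tau>(2) abs by (intro mult_left_mono) auto
      finally have err: "\<delta>' * r y \<le> \<bar>\<mu>\<bar> * \<bar>s y\<bar> / 4" by simp
      have lam: "sgn \<mu> * \<mu> = \<bar>\<mu>\<bar>" by (simp add: abs_sgn mult.commute)
      have "\<epsilon> * r (G y) \<le> \<epsilon> * (U * \<bar>s y\<bar> + \<bar>\<mu>\<bar> * \<bar>s y\<bar> / 4)"
        using Gy(1) err \<epsilon>(1) by (intro mult_left_mono) auto
      also have "\<dots> = (\<epsilon> * U) * \<bar>s y\<bar> + \<epsilon> * (\<bar>\<mu>\<bar> * \<bar>s y\<bar> / 4)" by (simp add: algebra_simps)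
      also have "\<dots> \<le> (\<bar>\<mu>\<bar> / 4) * \<bar>s y\<bar> + (1 / 2) * (\<bar>\<mu>\<bar> * \<bar>s y\<bar> / 4)"
        using \<epsilon>U(1) \<epsilon>(2) by (intro add_mono mult_right_mono) auto
      also have "\<dots> \<le> \<bar>\<mu>\<bar> * \<bar>s y\<bar> - \<bar>\<mu>\<bar> * \<bar>s y\<bar> / 4" by simp
      also have "\<dots> \<le> \<bar>\<mu>\<bar> * \<bar>s y\<bar> - \<bar>s (G y) - \<mu> * s y\<bar>" using Gy(2) err by linarith
      also have "\<dots> \<le> \<tau> * sgn \<mu> * (\<mu> * s y) + \<tau> * sgn \<mu> * (s (G y) - \<mu> * s y)"
      proof -
        have "\<tau> * sgn \<mu> * (\<mu> * s y) = \<bar>\<mu>\<bar> * \<bar>s y\<bar>" using lam abs by (simp add: algebra_simps)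
        moreover have "\<bar>\<tau> * sgn \<mu> * (s (G y) - \<mu> * s y)\<bar> = \<bar>s (G y) - \<mu> * s y\<bar>"
          using \<tau>(1) False by (simp add: abs_mult abs_sgn_eq)
        ultimately show ?thesis by linarith
      qed
      also have "\<dots> = \<tau> * sgn \<mu> * s (G y)" by (simp add: algebra_simps)
      finally show "\<epsilon> * r (G y) \<le> \<tau> * sgn \<mu> * s (G y)" .
    next
      show "continuous_on {0..1} (c \<kappa>)" unfolding c_def by (intro continuous_intros)
      show "c \<kappa> ` {0..1} \<subseteq> sphere 0 1" using c(1) [OF \<kappa>] by blast
      have small: "r (c \<kappa> t) \<le> 2 * \<kappa>" for t by (rule c(3) [OF \<kappa>])
      have "2 * \<kappa> < R0" unfolding \<kappa>_def using R0 by linarith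
      then show "r (c \<kappa> t) < R0" for t using small [of t] by linarith
      have "\<epsilon> * r (c \<kappa> t) \<le> 1 / 2 * (2 * \<kappa>)" for t
        using \<epsilon> small r0 by (intro mult_mono) auto
      then show "\<epsilon> * r (c \<kappa> 0) \<le> s (c \<kappa> 0)" "s (c \<kappa> 1) \<le> - \<epsilon> * r (c \<kappa> 1)"
        using c(4) [OF \<kappa>, of 0] c(4) [OF \<kappa>, of 1] by (simp_all add: minus_le_iff)
    qed
    then obtain t where t: "\<And>n. r ((G ^^ n) (c \<kappa> t)) < R0" by blast
    show thesis
    proof (rule that [of "c \<kappa> t"])
      show "norm ((G ^^ n) (c \<kappa> t) - p) < R" for n
        using t [of n] unfolding r_def R0_def by simp
    qed (use c(1,2) [OF \<kappa>] in auto)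
  qed
qed

section \<open>Smooth maps and the main result\<close>

lemma smooth_sphere_map_local_extension:
  assumes "smooth_sphere_map g" "p \<in> euclidean_2_sphere"
  obtains U F where "open U" "p \<in> U" "C_on 1 F U" "\<And>x. x \<in> U \<inter> euclidean_2_sphere \<Longrightarrow> F x = g x"
    "(g has_derivative frechet_derivative F (at p)) (at p within euclidean_2_sphere)"
proof -
  obtain U F where UF: "open U" "p \<in> U" "\<forall>k. C_on k F U" "\<forall>x \<in> U \<inter> euclidean_2_sphere. F x = g x"
    using assms unfolding smooth_sphere_map_def by blast
  have C1: "C_on 1 F U" using UF(3) by blast
  then have "(F has_derivative frechet_derivative F (at p)) (at p within euclidean_2_sphere)"
    using UF(2) by (simp add: frechet_derivative_works has_derivative_at_withinI)
  moreover obtain d where "d > 0" "ball p d \<subseteq> U" using UF(1,2) openE by blast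
  ultimately have "(g has_derivative frechet_derivative F (at p)) (at p within euclidean_2_sphere)"
    using has_derivative_transform_within [of F _ p euclidean_2_sphere d g] assms(2) UF(4)
    by (auto simp: subset_iff dist_commute)
  then show thesis using that UF C1 by blast
qed

text \<open>The contrapositive of the inverse function theorem, applied to a local extension of \<open>g\<close>.\<close>

lemma smooth_sphere_map_tangent_kernel:
  assumes g: "smooth_sphere_map g" and p: "p \<in> euclidean_2_sphere"
    and noninj: "\<And>W. \<lbrakk>open W; p \<in> W\<rbrakk> \<Longrightarrow> \<not> inj_on g (W \<inter> euclidean_2_sphere)"
  obtains A v where "(g has_derivative A) (at p within euclidean_2_sphere)" "v \<noteq> 0" "v \<bullet> p = 0" "A v = 0"
proof -
  obtain U F where UF: "open U" "p \<in> U" "C_on 1 F U" "\<And>x. x \<in> U \<inter> euclidean_2_sphere \<Longrightarrow> F x = g x"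
    and der: "(g has_derivative frechet_derivative F (at p)) (at p within euclidean_2_sphere)"
    using smooth_sphere_map_local_extension [OF g p] by blast
  have "\<not> inj_on F (W \<inter> sphere 0 (norm p))" if W: "open W" "p \<in> W" for W
  proof
    assume "inj_on F (W \<inter> sphere 0 (norm p))"
    then have "inj_on F (W \<inter> U \<inter> euclidean_2_sphere)"
      using p by (auto intro: inj_on_subset)
    then have "inj_on g (W \<inter> U \<inter> euclidean_2_sphere)"
      using UF(4) by (simp add: inj_on_def)
    then show False using noninj [of "W \<inter> U"] W UF(1,2) by (simp add: open_Int)
  qed
  then show thesis
    using not_injective_on_sphere_imp_tangent_kernel [OF UF(1-3)] der that by metis
qed

lemma differentiable_funpow:
  assumes "\<And>x. x \<in> S \<Longrightarrow> g differentiable (at x within S)" "g ` S \<subseteq> S" "x \<in> S"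
  shows "(g ^^ n) differentiable (at x within S)"
  using assms(3)
proof (induction n arbitrary: x)
  case (Suc n)
  have "(g ^^ n) differentiable (at (g x) within g ` S)"
    using Suc assms(2) by (meson differentiable_within_subset image_subset_iff)
  then have "((g ^^ n) \<circ> g) differentiable (at x within S)"
    using assms(1) [OF Suc.prems] by (intro differentiable_chain_within)
  then show ?case by (simp only: funpow_Suc_right)
qed (simp add: id_def)

theorem corollary1p2:
  fixes X :: "'a topology" and \<omega> :: "'a chain set" and f :: "'a \<Rightarrow> 'a"
  assumes "oriented_2_sphere X \<omega>"
    and "expanding_Thurston_map X \<omega> f"
    and "\<exists>x. periodic_critical_point X \<omega> f x"
  shows "\<not> (\<exists>g. smooth_sphere_map g \<and>
              topologically_conjugate X f (top_of_set euclidean_2_sphere) g)"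
proof clarify
  fix g assume g: "smooth_sphere_map g"
    and conj: "topologically_conjugate X f (top_of_set euclidean_2_sphere) g"
  let ?S = "euclidean_2_sphere"
  obtain h where h: "homeomorphic_map X (top_of_set ?S) h"
    and hf: "\<And>x. x \<in> topspace X \<Longrightarrow> h (f x) = g (h x)"
    using conj unfolding topologically_conjugate_def by blast
  have X: "X homeomorphic_space top_of_set ?S"
    using assms(1) unfolding oriented_2_sphere_def by blast
  have cov: "branched_covering_map X \<omega> f"
    using assms(2) unfolding expanding_Thurston_map_def Thurston_map_def by blast
  then have cont: "continuous_map X X f" unfolding branched_covering_map_def by blast
  then have fX: "f x \<in> topspace X" if "x \<in> topspace X" for x
    using that by (auto simp: continuous_map_def)
  have inj: "inj_on h (topspace X)" and im: "h ` topspace X = ?S"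
    using h by (auto simp: homeomorphic_eq_everything_map)
  obtain x N where crit: "x \<in> crit X \<omega> f" and N: "N \<ge> 1" "(f ^^ N) x = x"
    using assms(3) unfolding periodic_critical_point_def by blast
  have x: "x \<in> topspace X" using crit unfolding crit_def by blast
  define p where "p = h x"
  have p: "p \<in> ?S" unfolding p_def using im x by blast
  have fnX: "(f ^^ n) y \<in> topspace X" if "y \<in> topspace X" for n y
    by (induction n) (use that fX in auto)
  have hfn: "h ((f ^^ n) y) = (g ^^ n) (h y)" if "y \<in> topspace X" for n y
    by (induction n) (use that fnX hf in auto)
  have gS: "g ` ?S \<subseteq> ?S" using g unfolding smooth_sphere_map_def by blast

  \<comment> \<open>The conjugacy carries the failure of local injectivity of \<open>f\<close> at \<open>x\<close> to \<open>g\<close> at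
    \<open>p\<close>.\<close>
  have "\<not> inj_on g (W \<inter> ?S)" if W: "open W" "p \<in> W" for W
  proof
    assume inj_g: "inj_on g (W \<inter> ?S)"
    define V where "V = {y \<in> topspace X. h y \<in> W \<inter> ?S}"
    have "openin (top_of_set ?S) (W \<inter> ?S)" using openin_open_Int [OF W(1), of ?S] by (simp add: Int_commute)
    then have "openin X V"
      unfolding V_def by (rule openin_continuous_map_preimage [OF homeomorphic_imp_continuous_map [OF h]])
    moreover have "x \<in> V" unfolding V_def using x W(2) p unfolding p_def by blast
    moreover have "inj_on f V"
    proof (rule inj_onI)
      fix y z assume yz: "y \<in> V" "z \<in> V" "f y = f z"
      then have "g (h y) = g (h z)" using hf unfolding V_def by (metis (no_types, lifting) mem_Collect_eq)
      then have "h y = h z" using inj_onD [OF inj_g] yz unfolding V_def by blast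
      then show "y = z" using inj_onD [OF inj] yz unfolding V_def by blast
    qed
    ultimately show False using critical_point_not_locally_injective [OF cov crit] by blast
  qed
  then obtain A v where A: "(g has_derivative A) (at p within ?S)" and v: "v \<noteq> 0" "v \<bullet> p = 0" "A v = 0"
    using smooth_sphere_map_tangent_kernel [OF g p] by blast
  have diff: "g differentiable (at q within ?S)" if "q \<in> ?S" for q
    using smooth_sphere_map_local_extension [OF g that] unfolding differentiable_def by metis
  define G where "G = g ^^ N"
  \<comment> \<open>Splitting off the innermost factor \<open>g\<close> shows that the derivative of \<open>G\<close> at \<open>p\<close> kills
    \<open>v\<close> as well.\<close>
  have G_eq: "G = (g ^^ (N - 1)) \<circ> g"
    unfolding G_def using N(1) by (metis Suc_diff_1 funpow_Suc_right less_eq_Suc_le One_nat_def)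
  obtain B where "(g ^^ (N - 1) has_derivative B) (at (g p) within ?S)"
    using differentiable_funpow [OF diff gS, of "g p" "N - 1"] gS p unfolding differentiable_def by blast
  then have "(g ^^ (N - 1) has_derivative B) (at (g p) within g ` ?S)"
    using gS has_derivative_subset by blast
  then have G_der: "(G has_derivative (B \<circ> A)) (at p within ?S)"
    unfolding G_eq by (rule diff_chain_within [OF A])
  have "linear B" using \<open>(g ^^ (N - 1) has_derivative B) (at (g p) within ?S)\<close> has_derivative_linear by blast
  then have BA: "(B \<circ> A) v = 0" using v(3) linear_0 by simp
  have G_cont: "continuous_on ?S G"
    unfolding continuous_on_eq_continuous_within G_def
    using differentiable_funpow [OF diff gS] differentiable_imp_continuous_within by blast
  have GS: "G ` ?S \<subseteq> ?S"
    unfolding G_def by (induction N) (use gS in auto)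
  have Gp: "G p = p" unfolding G_def p_def using hfn [OF x, of N] N(2) by simp

  \<comment> \<open>An orbit of \<open>G\<close> that stays near \<open>p\<close> is the image of an orbit of \<open>f ^^ N\<close> that stays near
    \<open>x\<close>.\<close>
  obtain W where W: "openin X W" "x \<in> W" and isolated: "\<And>y. (\<And>n. ((f ^^ N) ^^ n) y \<in> W) \<Longrightarrow> y = x"
    using expanding_Thurston_map_isolating_neighbourhood [OF X assms(2) x N(2,1)] by blast
  have "openin (top_of_set ?S) (h ` W)"
    using h W(1) homeomorphic_imp_open_map open_map_def by blast
  then obtain R where R: "R > 0" "ball p R \<inter> ?S \<subseteq> h ` W"
    using W(2) unfolding openin_contains_ball p_def by blast
  obtain y where y: "y \<in> ?S" "y \<noteq> p" "\<And>n. norm ((G ^^ n) y - p) < R"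
    using degenerate_fixed_point_traps_nearby_point [OF G_cont GS _ Gp G_der v(1,2) BA R(1)] p by auto
  obtain z where z: "z \<in> topspace X" "y = h z" using y(1) im by blast
  have "((f ^^ N) ^^ n) z \<in> W" for n
  proof -
    have fz: "((f ^^ N) ^^ n) z \<in> topspace X" using fnX [OF z(1), of "n * N"] by (simp add: funpow_mult mult.commute)
    have eq: "h (((f ^^ N) ^^ n) z) = (G ^^ n) y"
      unfolding G_def z(2) using hfn [OF z(1), of "n * N"] by (simp add: funpow_mult mult.commute)
    then have "(G ^^ n) y \<in> ball p R \<inter> ?S"
      using y(3) [of n] imageI [OF fz, of h] unfolding im by (simp add: dist_norm norm_minus_commute)
    then obtain w where "w \<in> W" "h w = h (((f ^^ N) ^^ n) z)" using R(2) eq by auto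
    then show ?thesis using inj_onD [OF inj] fz W(1) openin_subset by (metis subsetD)
  qed
  then have "z = x" by (rule isolated)
  then show False using y(2) z(2) unfolding p_def by simp
qed

end
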